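(* Let $K$ be a knot in $S^3$ and let $J_K(t,q)=(J_{K,m}(t,q-\zeta_m))_{m\ge1}\in\mathcal{H}_{R_K}$, $R_K=\mathbb{Z}[t^{\pm1},\Delta_K(t)^{-1}]$, be the lift of its colored Jones polynomial. Then $$J_{K,1}(t,q-1)=J^{\mathrm{loop}}_K(t,q)\in\mathbb{Z}[t^{\pm1},\Delta_K(t)^{-1}][\![q-1]\!],$$ and the collection of series at roots of unity $J_{K,m}(t,q-\zeta_m)\in\mathbb{Z}[t^{\pm1},\Delta_K(t)^{-1}][t^{1/m},\zeta_m][\![q-\zeta_m]\!]$, $m\ge1$, exists, i.e. the loop expansion of the colored Jones polynomial is defined near all roots of unity. Moreover, these expansions determine one another after gluing with Frobenius twists: for all $m\ge1$ and primes $p$, $J_{K,m}$ re-expanded at $q=\zeta_{pm}$ equals $\varphi_pJ_{K,pm}$, and through these relations the expansions at roots of unity determine one another.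
   Context: Colored Jones polynomial: $J_{K,n}(q)\in\mathbb{Z}[q^{\pm1}]$, $n\ge1$, is the (framing-independent) quantum invariant of $K$ colored by the $n$-dimensional irreducible representation of $\mathfrak{sl}_2$, normalized to be $1$ on the unknot. $\Delta_K(t)\in\mathbb{Z}[t^{\pm1}]$ is the Alexander polynomial normalized by $\Delta_K(t)=\Delta_K(t^{-1})$, $\Delta_K(1)=1$. Loop expansion (Rozansky): $J^{\mathrm{loop}}_K(t,q)\in\mathbb{Z}[t^{\pm1},\Delta_K(t)^{-1}][\![q-1]\!]$ is the series, with $J^{\mathrm{loop}}_K(t,1)=1/\Delta_K(t)$, uniquely characterized by $J_{K,n}(q)=J^{\mathrm{loop}}_K(q^{n-1},q)$ in $\mathbb{Q}[n][\![q-1]\!]$ for all $n>0$. Roots of unity: fix primitive $m$-th roots of unity $\zeta_m$ ($m\ge1$) with $\zeta_{mm'}=\zeta_m\zeta_{m'}$ if $\gcd(m,m')=1$ and $(\zeta_{p^r})^p=\zeta_{p^{r-1}}$ for primes $p$, $r\ge1$. Then $\zeta_{pm}-\zeta_m$ is topologically nilpotent in $\mathbb{Z}_p[\zeta_{pm}]$, so power series in $q-\zeta_m=(q-\zeta_{pm})+(\zeta_{pm}-\zeta_m)$ can be re-expanded in $q-\zeta_{pm}$ after $p$-adic completion. Habiro ring: for $R=\mathbb{Z}[t^{\pm1},\Delta(t)^{-1}]$ and $p$ prime let $R_p=\varprojlim_n R/p^nR$ and let $\varphi_p:R_p\to R_p$ be the Frobenius lift with $\varphi_p(t)=t^p$;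 extend it by $t^{1/(pm)}\mapsto t^{1/m}$, $\varphi_p(q)=q$, $\varphi_p(\zeta)=\zeta$ for roots of unity $\zeta$. Then $\mathcal{H}_R$ is the ring of all collections $(f_m)_{m\ge1}\in\prod_{m\ge1}R[\zeta_m,t^{1/m}][\![q-\zeta_m]\!]$ such that for all $m\ge1$ and all primes $p$, $f_m$ re-expanded at $q=\zeta_{pm}$ equals $\varphi_p f_{pm}$ in $R_p[\zeta_{pm},t^{1/m}][\![q-\zeta_{pm}]\!]$. $\mathcal{H}_{\mathbb{Z}}$ is defined in the same way with $R$ replaced by $\mathbb{Z}$, no variable $t$ and $\varphi_p$ the identity; it contains $\mathbb{Z}[q^{\pm1}]$ by Taylor expansion at each $\zeta_m$. For $n\in\mathbb{Z}$ and $\Delta(1)=1$, $f(t,q)\mapsto f(q^n,q)$, $\mathcal{H}_R\to\mathcal{H}_{\mathbb{Z}}$, is given on the $m$-th component by $t^{1/m}\mapsto q^n$. The lift $J_K(t,q)\in\mathcal{H}_{R_K}$ is the element provided by the paper's main theorem; it satisfies $J_K(q^{n-1},q)=J_{K,n}(q)$ for all $n>0$. *)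

theory Defs
  imports
    "HOL-Analysis.Analysis"
    "HOL-Computational_Algebra.Computational_Algebra"
    "HOL-Library.Poly_Mapping"
    "HOL-Algebra.Algebra"
    "HOL-Algebra.Algebraic_Closure_Type"
    "Jordan_Normal_Form.Determinant"
begin

section \<open>Integral Laurent polynomials\<close>

text \<open>Poly mappings multiply by convolution, so this type is the group ring of the
  infinite cyclic group, with \<^term>\<open>Poly_Mapping.single i 1\<close> the \<open>i\<close>-th power of
  the variable.\<close>

type_synonym laurent = "int \<Rightarrow>\<^sub>0 int"

abbreviation var_pow :: "int \<Rightarrow> laurent" where
  "var_pow i \<equiv> Poly_Mapping.single i 1"

definition laurent_eval :: "laurent \<Rightarrow> 'a \<Rightarrow> 'a::{comm_ring_1, inverse}" where
  "laurent_eval P u = (\<Sum>i\<in>Poly_Mapping.keys P. of_int (Poly_Mapping.lookup P i) * u powi i)"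


section \<open>Knots and closed braids\<close>

text \<open>The 3-sphere is the unit sphere of \<open>\<complex>\<^sup>2\<close>, with its orientation as the boundary of the
  unit ball. Knots are unoriented; the invariants below do not depend on an orientation.\<close>

abbreviation S3 :: "(complex \<times> complex) set" where
  "S3 \<equiv> sphere 0 1"

definition knot :: "(complex \<times> complex) set \<Rightarrow> bool" where
  "knot K \<longleftrightarrow> K \<subseteq> S3 \<and>
     (\<exists>\<gamma> :: real \<Rightarrow> complex \<times> complex.
        \<gamma> C1_differentiable_on UNIV \<and>
        (\<forall>s. vector_derivative \<gamma> (at s) \<noteq> 0) \<and>
        (\<forall>s s'. \<gamma> s = \<gamma> s' \<longleftrightarrow> s - s' \<in> \<int>) \<and>
        K = range \<gamma>)"

definition ambient_isotopic :: "(complex \<times> complex) set \<Rightarrow> (complex \<times> complex) set \<Rightarrow> bool" where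
  "ambient_isotopic K L \<longleftrightarrow>
     (\<exists>H :: real \<times> (complex \<times> complex) \<Rightarrow> complex \<times> complex.
        continuous_on ({0..1} \<times> S3) H \<and>
        (\<forall>s\<in>{0..1}. \<exists>g. homeomorphism S3 S3 (\<lambda>x. H (s, x)) g) \<and>
        (\<forall>x\<in>S3. H (0, x) = x) \<and>
        (\<lambda>x. H (1, x)) ` K = L)"

text \<open>Braid words on \<open>N\<close> strands: the letter \<open>i\<close> is the generator \<open>\<sigma>\<^sub>i\<close> and \<open>-i\<close> its inverse.\<close>

definition braid_word :: "nat \<Rightarrow> int list \<Rightarrow> bool" where
  "braid_word N w \<longleftrightarrow> (\<forall>g\<in>set w. 1 \<le> \<bar>g\<bar> \<and> \<bar>g\<bar> < int N)"

text \<open>The strands start at the points \<open>1, \<dots>, N\<close> of the complex plane; \<open>\<sigma>\<^sub>i\<close> rotates the pair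
  \<open>i\<close>, \<open>i + 1\<close> counterclockwise by a half turn while \<open>s\<close> runs from 0 to 1.\<close>

definition strand_positions :: "nat \<Rightarrow> int \<Rightarrow> real \<Rightarrow> complex set" where
  "strand_positions N g s =
     (let c = of_int \<bar>g\<bar> + 1/2; r = cis (of_int (sgn g) * pi * s) / 2
      in of_int ` ({1..int N} - {\<bar>g\<bar>, \<bar>g\<bar> + 1}) \<union> {c + r, c - r})"

text \<open>The braid is wrapped around the solid torus with core \<open>{(u, 0). \<bar>u\<bar> = 1}\<close> by the radial
  projection of \<open>(e\<^sup>i\<^sup>\<theta>, z)\<close> to the sphere (\<open>sgn\<close> is normalisation of vectors), the \<open>k\<close>-th letter
  occupying the \<open>k\<close>-th arc of the circle. With these orientations a letter \<open>\<sigma>\<^sub>i\<close> is a positive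
  crossing: the closure of \<open>\<sigma>\<^sub>1\<^sup>2\<close> is the Hopf link of two complex lines, and that of
  \<open>\<sigma>\<^sub>1\<^sup>3\<close> the right-handed trefoil.\<close>

definition closed_braid :: "nat \<Rightarrow> int list \<Rightarrow> (complex \<times> complex) set" where
  "closed_braid N w =
     (\<Union>k<length w. \<Union>s\<in>{0..1}.
        (\<lambda>z. sgn (cis (2 * pi * (real k + s) / real (length w)), z)) ` strand_positions N (w ! k) s)"

text \<open>By Alexander's theorem every knot is represented by some braid word.\<close>

definition represents :: "nat \<Rightarrow> int list \<Rightarrow> (complex \<times> complex) set \<Rightarrow> bool" where
  "represents N w K \<longleftrightarrow> braid_word N w \<and> ambient_isotopic K (closed_braid N w)"


section \<open>The Alexander polynomial\<close>

text \<open>Fox calculus applied to Artin's presentation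
  \<open>\<langle>x\<^sub>1, \<dots>, x\<^sub>N | x\<^sub>i = \<beta>(x\<^sub>i)\<rangle>\<close> of the group of the closure of a braid \<open>\<beta>\<close> gives the Alexander
  matrix \<open>1 - Burau \<beta>\<close>, whose minors of size \<open>N - 1\<close> generate the first elementary ideal.\<close>

definition burau_generator :: "nat \<Rightarrow> int \<Rightarrow> laurent mat" where
  "burau_generator N g =
     (let i = nat \<bar>g\<bar> - 1 in
      Matrix.mat N N (\<lambda>(a, b).
        if a = i \<and> b = i then (if g > 0 then 1 - var_pow 1 else 0)
        else if a = i \<and> b = Suc i then (if g > 0 then var_pow 1 else 1)
        else if a = Suc i \<and> b = i then (if g > 0 then 1 else var_pow (-1))
        else if a = Suc i \<and> b = Suc i then (if g > 0 then 0 else 1 - var_pow (-1))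
        else if a = b then 1 else 0))"

definition burau :: "nat \<Rightarrow> int list \<Rightarrow> laurent mat" where
  "burau N w = foldr (\<lambda>g M. burau_generator N g * M) w (1\<^sub>m N)"

definition alexander_minor :: "nat \<Rightarrow> int list \<Rightarrow> laurent" where
  "alexander_minor N w = Determinant.det (mat_delete (1\<^sub>m N - burau N w) 0 0)"

text \<open>\<open>\<Delta>\<close> is the Alexander polynomial of \<open>K\<close>: an associate of a generator of the first elementary
  ideal (the units are \<open>\<plusminus>t\<^sup>j\<close>), with \<open>\<Delta>(t) = \<Delta>(t\<^sup>-\<^sup>1)\<close> and \<open>\<Delta>(1) = 1\<close>. The two
  normalisations leave exactly one choice.\<close>

definition alexander_polynomial :: "(complex \<times> complex) set \<Rightarrow> laurent \<Rightarrow> bool" where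
  "alexander_polynomial K \<Delta> \<longleftrightarrow>
     (\<exists>N w j. \<exists>\<epsilon>\<in>{1, -1}. represents N w K \<and> \<Delta> = \<epsilon> * var_pow j * alexander_minor N w) \<and>
     (\<forall>i. Poly_Mapping.lookup \<Delta> (- i) = Poly_Mapping.lookup \<Delta> i) \<and>
     laurent_eval \<Delta> (1 :: complex) = 1"


section \<open>The colored Jones polynomial\<close>

fun gauss_binomial :: "nat \<Rightarrow> nat \<Rightarrow> laurent" where
  "gauss_binomial n 0 = 1"
| "gauss_binomial 0 (Suc k) = 0"
| "gauss_binomial (Suc n) (Suc k) =
     gauss_binomial n k + var_pow (int (Suc k)) * gauss_binomial n (Suc k)"

text \<open>
  Matrix entries of the \<open>R\<close>-matrix of \<open>U\<^sub>q(sl\<^sub>2)\<close> on \<open>V \<otimes> V\<close>, where \<open>V\<close> is the irreducible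
  representation of dimension \<open>r + 1\<close>. With \<open>v = q\<^sup>1\<^sup>/\<^sup>2\<close> and \<open>{a} = v\<^sup>a - v\<^sup>-\<^sup>a\<close>,
  let \<open>e\<^sub>i = F\<^sup>i e\<^sub>0 / [i]!\<close>, so that \<open>E e\<^sub>i = [r - i + 1] e\<^sub>i\<^sub>-\<^sub>1\<close> and \<open>H e\<^sub>i = (r - 2i) e\<^sub>i\<close>. The flip composed
  with \<open>v\<^bsup>H \<otimes> H / 2\<^esup> \<Sum>\<^sub>k v\<^bsup>k(k-1)/2\<^esup> {1}\<^sup>k / [k]! E\<^sup>k \<otimes> F\<^sup>k\<close> maps \<open>e\<^sub>a \<otimes> e\<^sub>b\<close> to a combination of the
  \<open>e\<^bsub>b+k\<^esub> \<otimes> e\<^bsub>a-k\<^esub>\<close>. Two changes make the entries Laurent polynomials in \<open>q\<close>: the vector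
  \<open>e\<^bsub>a\<^sub>1\<^esub> \<otimes> \<dots> \<otimes> e\<^bsub>a\<^sub>N\<^esub>\<close> is multiplied by a power of \<open>v\<close> (a diagonal change of basis, which does not
  affect traces), and the matrix is divided by the framing factor \<open>v\<^bsup>r(r+2)/2\<^esup>\<close> and multiplied by
  \<open>v\<^sup>r\<close>. The inverse matrix maps \<open>e\<^sub>a \<otimes> e\<^sub>b\<close> to a combination of the \<open>e\<^bsub>b-k\<^esub> \<otimes> e\<^bsub>a+k\<^esub>\<close>.\<close>

definition R_entry :: "nat \<Rightarrow> nat \<Rightarrow> nat \<Rightarrow> nat \<Rightarrow> laurent" where
  "R_entry r a b k =
     var_pow (int a * int b - int k * int b - int r * int b) * gauss_binomial (b + k) k *
     (\<Prod>j = 1..k. 1 - var_pow (int a - int r - int j))"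

definition R_inv_entry :: "nat \<Rightarrow> nat \<Rightarrow> nat \<Rightarrow> nat \<Rightarrow> laurent" where
  "R_inv_entry r a b k =
     var_pow (int r * int a - int a * int b) * gauss_binomial (a + k) k *
     (\<Prod>j = 1..k. 1 - var_pow (int r - int b + int j))"

text \<open>The coefficient of the basis vector \<open>ys\<close> in the image of \<open>xs\<close> under the operator of a braid
  word; a basis vector of the tensor power of \<open>V\<close> is a list of indices in \<open>{0..r}\<close>.\<close>

fun braid_entry :: "nat \<Rightarrow> int list \<Rightarrow> nat list \<Rightarrow> nat list \<Rightarrow> laurent" where
  "braid_entry r [] xs ys = (if xs = ys then 1 else 0)"
| "braid_entry r (g # w) xs ys =
     (let i = nat \<bar>g\<bar> - 1; a = xs ! i; b = xs ! Suc i in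
      if g > 0
      then \<Sum>k\<le>min a (r - b).
             R_entry r a b k * braid_entry r w (xs[i := b + k, Suc i := a - k]) ys
      else \<Sum>k\<le>min b (r - a).
             R_inv_entry r a b k * braid_entry r w (xs[i := b - k, Suc i := a + k]) ys)"

text \<open>The partial quantum trace over all strands but the first, an endomorphism of the irreducible
  \<open>V\<close> and hence the scalar by which it acts on \<open>e\<^sub>0\<close>. The quantum trace weights \<open>e\<^sub>a\<close> by
  \<open>v\<^bsup>r - 2a\<^esup>\<close>, and the factors \<open>v\<^sup>r\<close> of the \<open>N - 1\<close> traced strands and \<open>v\<^sup>-\<^sup>r\<close> of each crossing
  of sign 1 are collected in front; their total exponent is even when the closure is a knot.
  The result is 1 on the unknot, and \<open>q\<^sup>-\<^sup>1 + q\<^sup>-\<^sup>3 - q\<^sup>-\<^sup>4\<close> on the right-handed trefoil for \<open>n = 2\<close>.\<close>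

definition braid_colored_jones :: "nat \<Rightarrow> int list \<Rightarrow> nat \<Rightarrow> laurent" where
  "braid_colored_jones N w n =
     (let r = n - 1; writhe = sum_list (map sgn w) in
      var_pow (- int r * ((writhe - int N + 1) div 2)) *
      (\<Sum>as | length as = N - 1 \<and> set as \<subseteq> {..r}.
         var_pow (- int (sum_list as)) * braid_entry r w (0 # as) (0 # as)))"

text \<open>Independence of the braid is the invariance theorem of Reshetikhin and Turaev.\<close>

definition colored_jones :: "(complex \<times> complex) set \<Rightarrow> nat \<Rightarrow> laurent" where
  "colored_jones K n = (THE P. \<exists>N w. represents N w K \<and> P = braid_colored_jones N w n)"


section \<open>Coefficient rings\<close>

definition compatible_roots :: "(nat \<Rightarrow> complex) \<Rightarrow> bool" where
  "compatible_roots \<zeta> \<longleftrightarrow>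
     (\<forall>m\<ge>1. \<zeta> m ^ m = 1 \<and> (\<forall>k. 0 < k \<and> k < m \<longrightarrow> \<zeta> m ^ k \<noteq> 1)) \<and>
     (\<forall>m\<ge>1. \<forall>m'\<ge>1. coprime m m' \<longrightarrow> \<zeta> (m * m') = \<zeta> m * \<zeta> m') \<and>
     (\<forall>p r. Factorial_Ring.prime p \<and> r \<ge> 1 \<longrightarrow> \<zeta> (p ^ r) ^ p = \<zeta> (p ^ (r - 1)))"

text \<open>All rings live in the field of rational functions in one indeterminate over the complex
  numbers. In the ring with \<open>t\<^sup>1\<^sup>/\<^sup>m\<close> adjoined the indeterminate stands for \<open>t\<^sup>1\<^sup>/\<^sup>m\<close>, so it has a
  different meaning for each \<open>m\<close>, and \<open>t\<close> is its \<open>m\<close>-th power.\<close>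

type_synonym ratfun = "complex poly fract"

definition indet :: ratfun where
  "indet = Fraction_Field.Fract [:0, 1:] 1"

definition const :: "complex \<Rightarrow> ratfun" where
  "const z = Fraction_Field.Fract [:z:] 1"

text \<open>The ring \<open>R[z, t\<^sup>1\<^sup>/\<^sup>m]\<close> for \<open>R = \<int>[t\<^sup>\<plusminus>\<^sup>1, \<Delta>(t)\<^sup>-\<^sup>1]\<close> and a root of unity \<open>z\<close>.\<close>

definition coeff_ring :: "laurent \<Rightarrow> complex \<Rightarrow> nat \<Rightarrow> ratfun set" where
  "coeff_ring \<Delta> z m =
     generate_ring ring_of_type_algebra
       {const z, indet, inverse indet, inverse (laurent_eval \<Delta> (indet ^ m))}"

definition series_over :: "ratfun set \<Rightarrow> ratfun fps set" where
  "series_over A = {f. \<forall>k. fps_nth f k \<in> A}"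


section \<open>Completion, re-expansion and Frobenius\<close>

definition ring_on :: "'a set \<Rightarrow> 'a::comm_ring_1 ring" where
  "ring_on A = ring_of_type_algebra \<lparr>carrier := A\<rparr>"

definition mod_pow :: "nat \<Rightarrow> 'a set \<Rightarrow> nat \<Rightarrow> 'a::comm_ring_1 set ring" where
  "mod_pow p A n = ring_on A Quot (PIdl\<^bsub>ring_on A\<^esub> (of_nat (p ^ n)))"

text \<open>The inverse limit of the rings \<open>A/p\<^sup>n A\<close>. The projections \<open>A/p\<^bsup>n+1\<^esup> A \<rightarrow> A/p\<^sup>n A\<close> map a coset
  to the coset containing it. For \<open>A = R[z, t\<^sup>1\<^sup>/\<^sup>m]\<close>, which is free of finite rank over \<open>R\<close>, this is
  \<open>R\<^sub>p[z, t\<^sup>1\<^sup>/\<^sup>m]\<close>.\<close>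

definition padic_completion :: "nat \<Rightarrow> 'a set \<Rightarrow> (nat \<Rightarrow> 'a::comm_ring_1 set) ring" where
  "padic_completion p A =
     \<lparr>carrier = {x. (\<forall>n. x n \<in> carrier (mod_pow p A n)) \<and> (\<forall>n. x (Suc n) \<subseteq> x n)},
      monoid.mult = (\<lambda>x y n. x n \<otimes>\<^bsub>mod_pow p A n\<^esub> y n),
      one = (\<lambda>n. \<one>\<^bsub>mod_pow p A n\<^esub>),
      ring.zero = (\<lambda>n. \<zero>\<^bsub>mod_pow p A n\<^esub>),
      add = (\<lambda>x y n. x n \<oplus>\<^bsub>mod_pow p A n\<^esub> y n)\<rparr>"

definition to_completion :: "nat \<Rightarrow> 'a set \<Rightarrow> 'a \<Rightarrow> nat \<Rightarrow> 'a::comm_ring_1 set" where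
  "to_completion p A a n = (PIdl\<^bsub>ring_on A\<^esub> (of_nat (p ^ n))) +>\<^bsub>ring_on A\<^esub> a"

definition padic_sums :: "nat \<Rightarrow> 'a set \<Rightarrow> (nat \<Rightarrow> 'a) \<Rightarrow> (nat \<Rightarrow> 'a::comm_ring_1 set) \<Rightarrow> bool" where
  "padic_sums p A c y \<longleftrightarrow> y \<in> carrier (padic_completion p A) \<and>
     (\<forall>n. \<forall>\<^sub>F N in sequentially. (\<Sum>k<N. c k) \<in> y n)"

text \<open>Substituting \<open>q - z = (q - z') + (z' - z)\<close> in \<open>\<Sum>\<^sub>k a\<^sub>k (q - z)\<^sup>k\<close> and expanding \<open>p\<close>-adically gives
  a series in \<open>q - z'\<close> over the completion of \<open>A\<close>, represented by its sequence of coefficients.\<close>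

definition reexpands_to ::
  "nat \<Rightarrow> ratfun set \<Rightarrow> complex \<Rightarrow> complex \<Rightarrow> ratfun fps \<Rightarrow> (nat \<Rightarrow> nat \<Rightarrow> ratfun set) \<Rightarrow> bool" where
  "reexpands_to p A z z' f y \<longleftrightarrow>
     (\<forall>j. padic_sums p A
        (\<lambda>k. of_nat ((j + k) choose j) * fps_nth f (j + k) * const (z' - z) ^ k) (y j))"

text \<open>The extension of \<open>\<phi>\<^sub>p\<close> to \<open>R\<^sub>p[\<zeta>\<^bsub>pm\<^esub>, t\<^bsup>1/(pm)\<^esup>] \<rightarrow> R\<^sub>p[\<zeta>\<^bsub>pm\<^esub>, t\<^bsup>1/m\<^esup>]\<close>; the indeterminate is
  \<open>t\<^bsup>1/(pm)\<^esup>\<close> in the source and \<open>t\<^bsup>1/m\<^esup>\<close> in the target. A ring homomorphism on the completion is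
  \<open>p\<close>-adically continuous, so these conditions characterise it uniquely; on \<open>R\<^sub>p\<close> it is the
  Frobenius lift with \<open>t \<mapsto> t\<^sup>p\<close>.\<close>

definition frobenius ::
  "(nat \<Rightarrow> complex) \<Rightarrow> laurent \<Rightarrow> nat \<Rightarrow> nat \<Rightarrow> ((nat \<Rightarrow> ratfun set) \<Rightarrow> nat \<Rightarrow> ratfun set) \<Rightarrow> bool" where
  "frobenius \<zeta> \<Delta> p m \<phi> \<longleftrightarrow>
     (let A' = coeff_ring \<Delta> (\<zeta> (p * m)) (p * m); A = coeff_ring \<Delta> (\<zeta> (p * m)) m in
      \<phi> \<in> Ring.ring_hom (padic_completion p A') (padic_completion p A) \<and>
      \<phi> (to_completion p A' indet) = to_completion p A indet \<and>
      \<phi> (to_completion p A' (const (\<zeta> (p * m)))) = to_completion p A (const (\<zeta> (p * m))))"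

text \<open>\<open>f\<close>, a series in \<open>q - \<zeta>\<^sub>m\<close>, re-expanded at \<open>\<zeta>\<^bsub>pm\<^esub>\<close> equals \<open>\<phi>\<^sub>p g\<close>, where \<open>g\<close> is a series in
  \<open>q - \<zeta>\<^bsub>pm\<^esub>\<close>.\<close>

definition glued ::
  "(nat \<Rightarrow> complex) \<Rightarrow> laurent \<Rightarrow> nat \<Rightarrow> nat \<Rightarrow> ratfun fps \<Rightarrow> ratfun fps \<Rightarrow> bool" where
  "glued \<zeta> \<Delta> p m f g \<longleftrightarrow>
     (\<exists>\<phi>. frobenius \<zeta> \<Delta> p m \<phi> \<and>
        reexpands_to p (coeff_ring \<Delta> (\<zeta> (p * m)) m) (\<zeta> m) (\<zeta> (p * m)) f
          (\<lambda>j. \<phi> (to_completion p (coeff_ring \<Delta> (\<zeta> (p * m)) (p * m)) (fps_nth g j))))"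


section \<open>The Habiro ring and the expansions of the colored Jones polynomial\<close>

definition habiro_ring :: "(nat \<Rightarrow> complex) \<Rightarrow> laurent \<Rightarrow> (nat \<Rightarrow> ratfun fps) set" where
  "habiro_ring \<zeta> \<Delta> =
     {f \<in> \<Pi>\<^sub>E m\<in>{1..}. series_over (coeff_ring \<Delta> (\<zeta> m) m).
        \<forall>m\<ge>1. \<forall>p. Factorial_Ring.prime p \<longrightarrow> glued \<zeta> \<Delta> p m (f m) (f (p * m))}"

text \<open>The variable \<open>q\<close> as a power series in \<open>q - z\<close>; \<open>laurent_eval P (q_at z)\<close> is the Taylor
  expansion of \<open>P(q)\<close> at \<open>z\<close>.\<close>

definition q_at :: "complex \<Rightarrow> complex fps" where
  "q_at z = fps_const z + fps_X"

definition ratfun_eval :: "ratfun \<Rightarrow> complex fps \<Rightarrow> complex fps" where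
  "ratfun_eval b u = (THE y. \<exists>P Q. b = Fraction_Field.Fract P Q \<and>
     fps_nth (poly (map_poly fps_const Q) u) 0 \<noteq> 0 \<and>
     y = poly (map_poly fps_const P) u * inverse (poly (map_poly fps_const Q) u))"

text \<open>The component at \<open>z\<close> of \<open>f(q\<^sup>n, q)\<close>: each coefficient is evaluated at indeterminate \<open>q\<^sup>n\<close>, and the
  resulting \<open>\<Sum>\<^sub>k b\<^sub>k (q - z)\<^sup>k\<close> with \<open>b\<^sub>k\<close> a power series in \<open>q - z\<close> is summed.\<close>

definition specialize :: "complex \<Rightarrow> int \<Rightarrow> ratfun fps \<Rightarrow> complex fps" where
  "specialize z n f =
     Abs_fps (\<lambda>N. \<Sum>k\<le>N. fps_nth (ratfun_eval (fps_nth f k) (q_at z powi n)) (N - k))"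

definition jones_lift ::
  "(nat \<Rightarrow> complex) \<Rightarrow> (complex \<times> complex) set \<Rightarrow> laurent \<Rightarrow> (nat \<Rightarrow> ratfun fps) \<Rightarrow> bool" where
  "jones_lift \<zeta> K \<Delta> J \<longleftrightarrow> J \<in> habiro_ring \<zeta> \<Delta> \<and>
     (\<forall>n>0. \<forall>m\<ge>1. specialize (\<zeta> m) (int n - 1) (J m) =
        laurent_eval (colored_jones K n) (q_at (\<zeta> m)))"

text \<open>Rozansky's theorem provides the series and its constant term \<open>1/\<Delta>(t)\<close>; the interpolation
  property determines it uniquely. The coefficients of both sides in powers of \<open>q - 1\<close> are
  polynomials in \<open>n\<close>, so that equality for all \<open>n > 0\<close> is equality over \<open>\<rat>[n]\<close>.\<close>

definition loop_expansion :: "(complex \<times> complex) set \<Rightarrow> laurent \<Rightarrow> ratfun fps" where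
  "loop_expansion K \<Delta> =
     (THE L. L \<in> series_over (coeff_ring \<Delta> 1 1) \<and>
        (\<forall>n>0. specialize 1 (int n - 1) L = laurent_eval (colored_jones K n) (q_at 1)))"

end

theory Submission
  imports Defs "Jordan_Normal_Form.Char_Poly"
begin

text \<open>Since \<open>\<Delta>(1) = 1\<close>, expansion at \<open>t\<^bsup>1/m\<^esup> = 1\<close> embeds the coefficient rings into power series over
  \<open>\<int>[\<zeta>]\<close>, which is \<open>p\<close>-adically separated because its nonzero elements are algebraic integers dividing
  nonzero integers. Hence nothing is lost in the completions. The Frobenius is determined by its values
  on the generators and is injective on \<open>R[\<zeta>, t\<^bsup>1/(pm)\<^esup>]\<close>, as it is the identity on polynomials in the
  generators and every element is a quotient of such polynomials; re-expansion is injective because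
  \<open>\<zeta>\<^bsub>pm\<^esub> - \<zeta>\<^sub>m\<close> is nilpotent modulo \<open>p\<close>. So the components at \<open>m\<close> and \<open>pm\<close> determine each other, and any
  two indices are connected through 1 by multiplication and division by primes. The component at 1 is
  the loop expansion since a series in \<open>q - 1\<close> is determined by its values at \<open>t = q\<^sup>r\<close> for all \<open>r \<ge> 0\<close>.\<close>

section \<open>Subrings and their \<open>p\<close>-adic completions\<close>

lemma ring_of_type_algebra_simps [simp]:
  "carrier ring_of_type_algebra = UNIV"
  "x \<otimes>\<^bsub>ring_of_type_algebra\<^esub> y = x * y"
  "x \<oplus>\<^bsub>ring_of_type_algebra\<^esub> y = x + y"
  "\<one>\<^bsub>ring_of_type_algebra\<^esub> = 1"
  "\<zero>\<^bsub>ring_of_type_algebra\<^esub> = 0"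
  by (simp_all add: ring_of_type_algebra_def)

lemma a_inv_ring_of_type_algebra [simp]:
  "\<ominus>\<^bsub>ring_of_type_algebra\<^esub> (x :: 'a::comm_ring_1) = - x"
proof -
  interpret cring "ring_of_type_algebra :: 'a ring" by (rule cring_from_type_algebra)
  have "x \<oplus>\<^bsub>ring_of_type_algebra\<^esub> \<ominus>\<^bsub>ring_of_type_algebra\<^esub> x = \<zero>\<^bsub>ring_of_type_algebra\<^esub>"
    by (rule r_neg) simp
  then show ?thesis
    by (metis add_eq_0_iff2 ring_of_type_algebra_simps(3,5) add.commute)
qed

text \<open>Closure is stated for the type-class operations, so calculations use plain arithmetic;
  \<open>ring_on A\<close> converts to a ring with explicit carrier when quotients and homomorphisms
  are needed.\<close>

locale subring_set =
  fixes A :: "'a::comm_ring_1 set"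
  assumes one_mem [simp]: "1 \<in> A"
    and uminus_mem [simp]: "x \<in> A \<Longrightarrow> - x \<in> A"
    and add_mem [simp]: "x \<in> A \<Longrightarrow> y \<in> A \<Longrightarrow> x + y \<in> A"
    and mult_mem [simp]: "x \<in> A \<Longrightarrow> y \<in> A \<Longrightarrow> x * y \<in> A"

lemma subring_set_generate_ring:
  "subring_set (generate_ring ring_of_type_algebra (H :: 'a::comm_ring_1 set))"
proof (unfold_locales)
  fix x y :: 'a
  assume x: "x \<in> generate_ring ring_of_type_algebra H"
  show "- x \<in> generate_ring ring_of_type_algebra H"
    using generate_ring.a_inv[OF x] by simp
  assume y: "y \<in> generate_ring ring_of_type_algebra H"
  show "x + y \<in> generate_ring ring_of_type_algebra H"
    using generate_ring.eng_add[OF x y] by simp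
  show "x * y \<in> generate_ring ring_of_type_algebra H"
    using generate_ring.eng_mult[OF x y] by simp
qed (use generate_ring.one[of "ring_of_type_algebra :: 'a ring" H] in simp)

text \<open>Induction over generated elements, packaged for later use: a property holds on the whole
  ring once its extension is a subring containing the generators.\<close>

lemma generate_ring_subset:
  assumes "subring_set A" "H \<subseteq> A"
  shows "generate_ring ring_of_type_algebra H \<subseteq> A"
proof
  interpret subring_set A by fact
  fix x assume "x \<in> generate_ring ring_of_type_algebra H"
  then show "x \<in> A" by induction (use assms(2) in auto)
qed

context subring_set
begin

lemma zero_mem [simp]: "0 \<in> A"
  using add_mem[of 1 "- 1"] by simp

lemma diff_mem [simp]: "x \<in> A \<Longrightarrow> y \<in> A \<Longrightarrow> x - y \<in> A"
  using add_mem[of x "- y"] by simp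

lemma of_nat_mem [simp]: "of_nat k \<in> A"
  by (induction k) auto

lemma of_int_mem [simp]: "of_int k \<in> A"
  by (cases k) auto

lemma power_mem [simp]: "x \<in> A \<Longrightarrow> x ^ k \<in> A"
  by (induction k) auto

lemma sum_mem: "(\<And>i. i \<in> I \<Longrightarrow> f i \<in> A) \<Longrightarrow> sum f I \<in> A"
  by (induction I rule: infinite_finite_induct) auto

section \<open>Principal ideals and congruence modulo powers of \<open>p\<close>\<close>

definition multiples :: "'a \<Rightarrow> 'a set" where
  "multiples c = (\<lambda>r. r * c) ` A"

lemma multiples_iff: "x \<in> multiples c \<longleftrightarrow> (\<exists>r\<in>A. x = r * c)"
  by (auto simp: multiples_def)

lemma multiples_add: "x \<in> multiples c \<Longrightarrow> y \<in> multiples c \<Longrightarrow> x + y \<in> multiples c"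
  unfolding multiples_iff by (metis add_mem distrib_right)

lemma multiples_mult: "x \<in> multiples c \<Longrightarrow> a \<in> A \<Longrightarrow> a * x \<in> multiples c"
  unfolding multiples_iff by (metis mult_mem mult.assoc)

lemma multiples_zero [simp]: "0 \<in> multiples c"
  unfolding multiples_iff by (rule bexI[of _ 0]) auto

lemma multiples_uminus: "x \<in> multiples c \<Longrightarrow> - x \<in> multiples c"
  using multiples_mult[of x c "- 1"] by simp

lemma multiples_diff: "x \<in> multiples c \<Longrightarrow> y \<in> multiples c \<Longrightarrow> x - y \<in> multiples c"
  using multiples_add[of x c "- y"] multiples_uminus[of y c] by simp

lemma multiples_sum: "(\<And>i. i \<in> I \<Longrightarrow> f i \<in> multiples c) \<Longrightarrow> sum f I \<in> multiples c"
  by (induction I rule: infinite_finite_induct) (auto intro: multiples_add)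

lemma multiples_subset: "c \<in> A \<Longrightarrow> multiples c \<subseteq> A"
  by (auto simp: multiples_iff)

lemma ring_on_simps [simp]:
  "carrier (ring_on A) = A"
  "x \<otimes>\<^bsub>ring_on A\<^esub> y = x * y"
  "x \<oplus>\<^bsub>ring_on A\<^esub> y = x + y"
  "\<one>\<^bsub>ring_on A\<^esub> = 1"
  "\<zero>\<^bsub>ring_on A\<^esub> = 0"
  by (simp_all add: ring_on_def ring_of_type_algebra_def)

lemma cring_ring_on: "cring (ring_on A)"
proof (rule cringI)
  show "abelian_group (ring_on A)"
    by (rule abelian_groupI) (auto simp: algebra_simps intro: bexI[of _ "- x" for x])
  show "comm_monoid (ring_on A)"
    by (rule comm_monoidI) (auto simp: algebra_simps)
qed (auto simp: algebra_simps)

lemma PIdl_eq: "PIdl\<^bsub>ring_on A\<^esub> c = multiples c"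
  by (auto simp: cgenideal_def multiples_iff)

lemma ideal_multiples: "c \<in> A \<Longrightarrow> ideal (multiples c) (ring_on A)"
  using cring.cgenideal_ideal[OF cring_ring_on, of c] by (simp add: PIdl_eq)

lemma to_completion_altdef: "to_completion p A a n = {h + a | h. h \<in> multiples (of_nat (p ^ n))}"
  unfolding to_completion_def PIdl_eq a_r_coset_def r_coset_def
  by (auto simp: ring_on_def ring_of_type_algebra_def)

lemma mem_to_completion_iff: "x \<in> to_completion p A a n \<longleftrightarrow> x - a \<in> multiples (of_nat (p ^ n))"
  unfolding to_completion_altdef by (auto intro: exI[of _ "x - a"])

lemma to_completion_self [simp]: "a \<in> to_completion p A a n"
  by (simp add: mem_to_completion_iff)

lemma to_completion_eqI:
  assumes "x - y \<in> multiples (of_nat (p ^ n))"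
  shows "to_completion p A x n = to_completion p A y n"
proof -
  have "z - x \<in> multiples (of_nat (p ^ n)) \<longleftrightarrow> z - y \<in> multiples (of_nat (p ^ n))" for z
    using multiples_add[OF _ assms, of "z - x"] multiples_diff[OF _ assms, of "z - y"] by auto
  then show ?thesis by (auto simp: mem_to_completion_iff)
qed

lemma to_completion_eq_iff:
  "to_completion p A x n = to_completion p A y n \<longleftrightarrow> x - y \<in> multiples (of_nat (p ^ n))"
  using to_completion_eqI to_completion_self mem_to_completion_iff by metis

section \<open>The quotients by \<open>p ^ n\<close> and their inverse limit\<close>

lemma cring_mod_pow: "cring (mod_pow p A n)"
  unfolding mod_pow_def PIdl_eq
  by (rule ideal.quotient_is_cring) (auto intro: ideal_multiples cring_ring_on simp flip: of_nat_power)

lemma to_completion_hom: "(\<lambda>a. to_completion p A a n) \<in> Ring.ring_hom (ring_on A) (mod_pow p A n)"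
  unfolding to_completion_def mod_pow_def PIdl_eq
  by (rule ideal.rcos_ring_hom) (auto intro: ideal_multiples simp flip: of_nat_power)

lemmas to_completion_mod_pow =
  ring_hom_mult[OF to_completion_hom, simplified]
  ring_hom_add[OF to_completion_hom, simplified]
  ring_hom_one[OF to_completion_hom, simplified]
  ring_hom_closed[OF to_completion_hom, simplified]

lemma carrier_mod_pow: "carrier (mod_pow p A n) = (\<lambda>a. to_completion p A a n) ` A"
  by (auto simp: mod_pow_def FactRing_def A_RCOSETS_def RCOSETS_def to_completion_def
      a_r_coset_def ring_on_def ring_of_type_algebra_def)

lemma coset_eq:
  assumes "c \<in> carrier (mod_pow p A n)" "x \<in> c"
  shows "c = to_completion p A x n"
proof -
  obtain a where "c = to_completion p A a n" using assms(1) by (auto simp: carrier_mod_pow)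
  then show ?thesis using assms(2) by (simp add: mem_to_completion_iff to_completion_eq_iff
        to_completion_eqI)
qed

lemma to_completion_closed:
  assumes "a \<in> A" shows "to_completion p A a \<in> carrier (padic_completion p A)"
proof -
  have "to_completion p A a (Suc n) \<subseteq> to_completion p A a n" for n
  proof -
    have "multiples (of_nat (p ^ Suc n)) \<subseteq> multiples (of_nat (p ^ n))"
    proof
      fix x assume "x \<in> multiples (of_nat (p ^ Suc n))"
      then obtain r where "r \<in> A" "x = r * of_nat (p ^ Suc n)" by (auto simp: multiples_iff)
      then have "r * of_nat p \<in> A" "x = r * of_nat p * of_nat (p ^ n)" by (auto simp: algebra_simps)
      then show "x \<in> multiples (of_nat (p ^ n))" unfolding multiples_iff by blast
    qed
    then show ?thesis by (auto simp: mem_to_completion_iff)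
  qed
  with assms show ?thesis by (simp add: padic_completion_def to_completion_mod_pow)
qed

lemma to_completion_ring_hom:
  "to_completion p A \<in> Ring.ring_hom (ring_on A) (padic_completion p A)"
proof (rule ring_hom_memI)
  show "to_completion p A x \<in> carrier (padic_completion p A)" if "x \<in> carrier (ring_on A)" for x
    using that by (simp add: to_completion_closed)
qed (auto simp: to_completion_mod_pow padic_completion_def)

text \<open>At each level \<open>n\<close> some partial sum lies in both components, and a coset is
  determined by any of its elements.\<close>

lemma padic_sums_unique:
  assumes "padic_sums p A c y" "padic_sums p A c y'"
  shows "y = y'"
proof
  fix n
  have "\<forall>\<^sub>F N in sequentially. (\<Sum>k<N. c k) \<in> y n \<and> (\<Sum>k<N. c k) \<in> y' n"
    using assms by (auto simp: padic_sums_def intro: eventually_conj)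
  then obtain N where "(\<Sum>k<N. c k) \<in> y n" "(\<Sum>k<N. c k) \<in> y' n"
    by (auto simp: eventually_sequentially)
  moreover have "y n \<in> carrier (mod_pow p A n)" "y' n \<in> carrier (mod_pow p A n)"
    using assms by (auto simp: padic_sums_def padic_completion_def)
  ultimately show "y n = y' n" using coset_eq by metis
qed

text \<open>Modulo \<open>p ^ n\<close>, late partial sums of both series lie in one coset. This
  turns the equality of two re-expansions into congruences inside \<open>A\<close>, without
  reference to the completion.\<close>

lemma padic_sums_diff:
  assumes "padic_sums p A c y" "padic_sums p A d y"
  shows "\<forall>\<^sub>F N in sequentially. (\<Sum>k<N. c k - d k) \<in> multiples (of_nat (p ^ n))"
proof -
  have "\<forall>\<^sub>F N in sequentially. (\<Sum>k<N. c k) \<in> y n \<and> (\<Sum>k<N. d k) \<in> y n"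
    using assms by (auto simp: padic_sums_def intro: eventually_conj)
  moreover have "y n \<in> carrier (mod_pow p A n)"
    using assms by (auto simp: padic_sums_def padic_completion_def)
  ultimately show ?thesis
  proof (elim eventually_mono, goal_cases)
    case (1 N)
    then have "to_completion p A (\<Sum>k<N. c k) n = to_completion p A (\<Sum>k<N. d k) n"
      using coset_eq by metis
    then show ?case by (simp add: to_completion_eq_iff sum_subtractf)
  qed
qed

text \<open>The intersection of the ideals \<open>p ^ n A\<close> is the kernel of the map from
  \<open>A\<close> to its completion. The case \<open>n = 0\<close> confines \<open>a\<close> to
  \<open>A\<close>.\<close>

definition padically_separated :: "nat \<Rightarrow> bool" where
  "padically_separated p \<longleftrightarrow> (\<forall>a. (\<forall>n. a \<in> multiples (of_nat (p ^ n))) \<longrightarrow> a = 0)"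

lemma to_completion_inject:
  assumes "padically_separated p" "to_completion p A x = to_completion p A y"
  shows "x = y"
proof -
  have "x - y \<in> multiples (of_nat (p ^ n))" for n
    using assms(2) to_completion_eq_iff[of p x n y] by simp
  with assms(1) have "x - y = 0" unfolding padically_separated_def by blast
  then show ?thesis by simp
qed

end

section \<open>Rings generated by a root of unity\<close>

text \<open>An element of \<open>\<int>[z]\<close> is an eigenvalue of the integer matrix by which it multiplies the
  generators \<open>1, z, \<dots>, z\<^bsup>M-1\<^esup>\<close>.\<close>

lemma algebraic_int_generated_by_root_of_unity:
  fixes z :: complex
  assumes z: "z ^ M = 1" "M > 0" and \<alpha>: "\<alpha> \<in> generate_ring ring_of_type_algebra {z}"
  shows "algebraic_int \<alpha>"
proof -
  \<comment> \<open>The powers of \<open>z\<close> below \<open>M\<close> may be linearly dependent,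
    so the matrix \<open>a\<close> is not unique; having such a matrix is a property that the ring
    operations preserve.\<close>
  define S where "S = {\<alpha>. \<exists>a :: nat \<Rightarrow> nat \<Rightarrow> int. \<forall>i<M. (\<Sum>j<M. of_int (a i j) * z ^ j) = \<alpha> * z ^ i}"
  have "subring_set S"
  proof
    show "1 \<in> S"
    proof -
      have "(\<Sum>j<M. of_int (of_bool (i = j)) * z ^ j) = z ^ i" if "i < M" for i
      proof -
        have "(\<Sum>j<M. of_int (of_bool (i = j)) * z ^ j) = (\<Sum>j<M. if i = j then z ^ j else 0)"
          by (intro sum.cong) auto
        then show ?thesis using that by simp
      qed
      then show ?thesis unfolding S_def by (auto intro!: exI[of _ "\<lambda>i j. of_bool (i = j)"])
    qed
  next
    fix x assume "x \<in> S"
    then obtain a where "\<forall>i<M. (\<Sum>j<M. of_int (a i j) * z ^ j) = x * z ^ i" by (auto simp: S_def)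
    then show "- x \<in> S"
      by (auto simp: S_def sum_negf intro!: exI[of _ "\<lambda>i j. - a i j"])
  next
    fix x y assume "x \<in> S" "y \<in> S"
    then obtain a b where a: "\<forall>i<M. (\<Sum>j<M. of_int (a i j) * z ^ j) = x * z ^ i"
      and b: "\<forall>i<M. (\<Sum>j<M. of_int (b i j) * z ^ j) = y * z ^ i" by (auto simp: S_def)
    then show "x + y \<in> S"
      by (auto simp: S_def algebra_simps sum.distrib intro!: exI[of _ "\<lambda>i j. a i j + b i j"])
    have "(\<Sum>k<M. of_int (\<Sum>j<M. a i j * b j k) * z ^ k) = x * y * z ^ i" if "i < M" for i
    proof -
      have "(\<Sum>k<M. of_int (\<Sum>j<M. a i j * b j k) * z ^ k) =
        (\<Sum>k<M. \<Sum>j<M. of_int (a i j) * (of_int (b j k) * z ^ k))"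
        unfolding of_int_sum sum_distrib_right by (intro sum.cong refl) simp
      also have "\<dots> = (\<Sum>j<M. of_int (a i j) * (\<Sum>k<M. of_int (b j k) * z ^ k))"
        unfolding sum_distrib_left by (rule sum.swap)
      also have "\<dots> = (\<Sum>j<M. of_int (a i j) * (y * z ^ j))"
        using b by (intro sum.cong) auto
      also have "\<dots> = (\<Sum>j<M. of_int (a i j) * z ^ j) * y"
        unfolding sum_distrib_right by (intro sum.cong refl) (simp only: mult_ac)
      also have "\<dots> = x * y * z ^ i"
        unfolding a[rule_format, OF that] by (simp only: mult_ac)
      finally show ?thesis .
    qed
    then show "x * y \<in> S"
      unfolding S_def by (intro CollectI exI[of _ "\<lambda>i k. \<Sum>j<M. a i j * b j k"]) simp
  qed
  moreover have "z \<in> S"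
  proof -
    \<comment> \<open>Since \<open>z ^ M = 1\<close>, multiplication by \<open>z\<close> permutes
      the generators cyclically, which gives a permutation matrix.\<close>
    have "(\<Sum>j<M. of_int (of_bool (j = Suc i mod M)) * z ^ j) = z * z ^ i" if "i < M" for i
    proof -
      have "(\<Sum>j<M. of_int (of_bool (j = Suc i mod M)) * z ^ j) =
        (\<Sum>j<M. if j = Suc i mod M then z ^ j else 0)"
        by (intro sum.cong) auto
      also have "\<dots> = z ^ (Suc i mod M)"
        using z(2) by (subst sum.delta) auto
      also have "\<dots> = z ^ Suc i"
      proof (cases "Suc i = M")
        case False
        with that have "Suc i < M" by simp
        then show ?thesis by simp
      qed (use z in simp)
      finally show ?thesis by simp
    qed
    then show ?thesis
      unfolding S_def by (intro CollectI exI[of _ "\<lambda>i j. of_bool (j = Suc i mod M)"]) simp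
  qed
  ultimately have "\<alpha> \<in> S"
    using \<alpha> generate_ring_subset[of S "{z}"] by auto
  then obtain a where a: "\<forall>i<M. (\<Sum>j<M. of_int (a i j) * z ^ j) = \<alpha> * z ^ i"
    by (auto simp: S_def)
  define A :: "int mat" where "A = Matrix.mat M M (\<lambda>(i, j). a i j)"
  define B :: "complex mat" where "B = map_mat of_int A"
  define v where "v = Matrix.vec M (\<lambda>i. z ^ i)"
  have A: "A \<in> carrier_mat M M" and B: "B \<in> carrier_mat M M" by (simp_all add: A_def B_def)
  have "B *\<^sub>v v = \<alpha> \<cdot>\<^sub>v v"
    using a by (intro eq_vecI) (auto simp: A_def B_def v_def scalar_prod_def atLeast0LessThan)
  moreover have "v \<noteq> 0\<^sub>v (dim_row B)"
  proof
    assume "v = 0\<^sub>v (dim_row B)"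
    then have "v $ 0 = 0\<^sub>v M $ 0" using B by auto
    then show False using z(2) by (simp add: v_def)
  qed
  ultimately have "eigenvalue B \<alpha>"
    unfolding eigenvalue_def eigenvector_def using B by (intro exI[of _ v]) (auto simp: v_def)
  then have "poly (char_poly B) \<alpha> = 0"
    using eigenvalue_root_char_poly[OF B] by simp
  \<comment> \<open>The matrix is integral, so its characteristic polynomial is a monic integer
    polynomial with root \<alpha>.\<close>
  moreover have "char_poly B = map_poly of_int (char_poly A)"
    unfolding B_def by (rule of_int_hom.char_poly_hom[OF A])
  ultimately have "poly (map_poly of_int (char_poly A)) \<alpha> = 0"
    by (simp only:)
  then show ?thesis
    unfolding algebraic_int_altdef_ipoly
    using degree_monic_char_poly[OF A] by (intro exI[of _ "char_poly A"]) auto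
qed

lemma poly_of_int_mem:
  assumes "subring_set A" "x \<in> A"
  shows "poly (map_poly of_int q) x \<in> A"
proof -
  interpret subring_set A by fact
  show ?thesis using assms(2) by (induction q) (auto simp: map_poly_pCons)
qed

text \<open>A nonzero \<alpha> divides a nonzero integer \<open>c\<close>, namely the lowest nonzero
  coefficient of a monic equation for it. If every \<open>p ^ n\<close> divides \<alpha>, then
  \<open>c / p ^ n\<close> is an algebraic integer and rational, hence an integer, for all
  \<open>n\<close>.\<close>

lemma padically_separated_generated_by_root_of_unity:
  fixes z :: complex
  assumes z: "z ^ M = 1" "M > 0" and p: "p > 1"
  shows "subring_set.padically_separated (generate_ring ring_of_type_algebra {z}) p"
proof -
  let ?O = "generate_ring ring_of_type_algebra {z}"
  interpret subring_set ?O by (rule subring_set_generate_ring)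
  show ?thesis
    unfolding padically_separated_def
  proof (intro allI impI, rule ccontr)
    fix \<alpha> assume \<alpha>: "\<forall>n. \<alpha> \<in> multiples (of_nat (p ^ n))" "\<alpha> \<noteq> 0"
    have \<alpha>O: "\<alpha> \<in> ?O" using \<alpha>(1)[rule_format, of 0] multiples_subset[of 1] by auto
    then have "algebraic_int \<alpha>" by (rule algebraic_int_generated_by_root_of_unity[OF z])
    then obtain P where P: "poly (map_poly of_int P) \<alpha> = 0" "Polynomial.lead_coeff P = 1"
      by (auto simp: algebraic_int_altdef_ipoly)
    then have "P \<noteq> 0" by auto
    \<comment> \<open>Removing all factors of the indeterminate makes the constant term nonzero, and
      \<alpha>, being nonzero, remains a root.\<close>
    then obtain Q where Q: "P = [:- 0, 1:] ^ Polynomial.order 0 P * Q" "\<not> [:- 0, 1:] dvd Q"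
      using order_decomp by blast
    have "poly (map_poly of_int P) \<alpha> = \<alpha> ^ Polynomial.order 0 P * poly (map_poly of_int Q) \<alpha>"
      by (subst Q(1)) (simp only: of_int_poly_hom.hom_mult of_int_poly_hom.hom_power poly_mult poly_power, simp)
    with P \<alpha> have Q0: "poly (map_poly of_int Q) \<alpha> = 0" by simp
    obtain c Q' where Q': "Q = pCons c Q'" by (cases Q)
    with Q(2) have "c \<noteq> 0" by (simp add: dvd_iff_poly_eq_0)
    \<comment> \<open>Evaluating \<open>Q = c + x Q'\<close> at its root \<alpha> exhibits \<gamma>
      as the cofactor of \<alpha> in \<open>c\<close>.\<close>
    define \<gamma> where "\<gamma> = - poly (map_poly of_int Q') \<alpha>"
    have "of_int c + \<alpha> * poly (map_poly of_int Q') \<alpha> = 0"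
      using Q0 by (simp only: Q' of_int_hom.map_poly_pCons_hom poly_pCons)
    then have "of_int c = - (\<alpha> * poly (map_poly of_int Q') \<alpha>)"
      by (simp only: eq_neg_iff_add_eq_0)
    moreover have "\<gamma> \<in> ?O"
      unfolding \<gamma>_def using \<alpha>O by (intro uminus_mem poly_of_int_mem[OF subring_set_axioms])
    ultimately have \<gamma>: "\<gamma> \<in> ?O" "\<alpha> * \<gamma> = of_int c"
      by (simp_all add: \<gamma>_def)
    have "int (p ^ n) dvd c" for n
    proof -
      obtain r where r: "r \<in> ?O" "\<alpha> = r * of_nat (p ^ n)" using \<alpha>(1)[rule_format, of n] unfolding multiples_iff by blast
      then have eq: "of_int c = r * \<gamma> * of_nat (p ^ n)" using \<gamma>(2) by (simp only: mult_ac)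
      moreover have "(of_nat (p ^ n) :: complex) \<noteq> 0" using p by simp
      ultimately have "r * \<gamma> = of_int c / of_nat (p ^ n)" by (simp only: nonzero_mult_div_cancel_right simp_thms)
      moreover have "of_int c / of_nat (p ^ n) \<in> (\<rat> :: complex set)" by simp
      moreover have "algebraic_int (r * \<gamma>)"
        using r \<gamma> by (intro algebraic_int_generated_by_root_of_unity[OF z]) simp
      ultimately have "r * \<gamma> \<in> \<int>" using rational_algebraic_int_is_int by metis
      then obtain k where "r * \<gamma> = of_int k" by (elim Ints_cases)
      with eq have "(of_int c :: complex) = of_int (k * int (p ^ n))"
        by (simp only: of_int_mult of_int_of_nat_eq)
      then have "c = k * int (p ^ n)" by (subst (asm) of_int_eq_iff)
      then show ?thesis by simp
    qed
    \<comment> \<open>The exponent is chosen so that the power of \<open>p\<close> exceeds the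
      absolute value of \<open>c\<close>.\<close>
    then have "\<bar>int (p ^ nat \<bar>c\<bar>)\<bar> \<le> \<bar>c\<bar>"
      by (rule dvd_imp_le_int[OF \<open>c \<noteq> 0\<close>])
    moreover have "nat \<bar>c\<bar> < p ^ nat \<bar>c\<bar>" by (rule power_gt_expt) (use p in simp)
    ultimately show False by linarith
  qed
qed

section \<open>Expansion of rational functions\<close>

abbreviation eval_at :: "complex poly \<Rightarrow> complex fps \<Rightarrow> complex fps" where
  "eval_at P u \<equiv> poly (map_poly fps_const P) u"

text \<open>The local ring at the point 1. Its elements can be evaluated at every power series with
  constant term 1, such as \<open>q\<close> to an integer power expanded at
  \<open>q = 1\<close>.\<close>

definition regular :: "ratfun \<Rightarrow> bool" where
  "regular b \<longleftrightarrow> (\<exists>P Q. b = Fraction_Field.Fract P Q \<and> poly Q 1 \<noteq> 0)"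

lemma eval_at_add [simp]: "eval_at (P + Q) u = eval_at P u + eval_at Q u"
proof -
  have "map_poly fps_const (P + Q) = map_poly fps_const P + map_poly fps_const Q"
    by (intro poly_eqI) (simp add: coeff_map_poly)
  then show ?thesis by simp
qed

lemma eval_at_pCons [simp]: "eval_at (pCons a P) u = fps_const a + u * eval_at P u"
  by (simp add: Polynomial.map_poly_pCons)

lemma eval_at_smult [simp]: "eval_at (Polynomial.smult c P) u = fps_const c * eval_at P u"
  by (induction P) (auto simp: algebra_simps)

lemma eval_at_mult [simp]: "eval_at (P * Q) u = eval_at P u * eval_at Q u"
  by (induction P) (auto simp: algebra_simps)

lemma eval_at_nth_0: "fps_nth (eval_at P u) 0 = poly P (fps_nth u 0)"
  by (induction P) auto

lemma eval_at_compose: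
  assumes "fps_nth y 0 = 0"
  shows "eval_at P (u oo y) = eval_at P u oo y"
  by (induction P) (use assms in \<open>auto simp: fps_compose_add_distrib fps_compose_mult_distrib\<close>)

text \<open>Evaluation at \<open>1 + fps_X\<close> is the substitution of \<open>1 + x\<close> for
  the variable, an injective operation on polynomials.\<close>

lemma eval_at_eq_0_iff: "eval_at P (1 + fps_X) = 0 \<longleftrightarrow> P = 0"
proof -
  have "eval_at P (1 + fps_X) = fps_of_poly (pcompose P [:1, 1:])"
    by (induction P) (auto simp: pcompose_pCons fps_of_poly_add fps_of_poly_mult fps_of_poly_pCons
        algebra_simps)
  then show ?thesis by (simp add: pcompose_eq_0_iff)
qed

text \<open>Comparison of two fractions in a ring that need not be a field: the inverses of the two
  denominators are supplied explicitly.\<close>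

lemma cross_multiply:
  fixes a :: "'a::comm_ring_1"
  assumes "a * a' = 1" "b * b' = 1" "x * b = y * a"
  shows "y * b' = x * a'"
proof -
  have "y * b' = y * b' * (a * a')"
    by (simp add: assms(1))
  also have "\<dots> = (y * a) * (a' * b')"
    by (simp only: mult_ac)
  also have "\<dots> = x * a' * (b * b')"
    unfolding assms(3)[symmetric] by (simp only: mult_ac)
  finally show ?thesis using assms(2) by simp
qed

text \<open>Cross-multiplication shows that all admissible representations as a fraction have the
  same value, which resolves the definite description in \<open>ratfun_eval\<close>.\<close>

lemma ratfun_eval_Fract:
  assumes u: "fps_nth u 0 = 1" and Q: "poly Q 1 \<noteq> 0"
  shows "ratfun_eval (Fraction_Field.Fract P Q) u = eval_at P u * inverse (eval_at Q u)"
  unfolding ratfun_eval_def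
proof (rule the_equality)
  show "\<exists>P' Q'. Fraction_Field.Fract P Q = Fraction_Field.Fract P' Q' \<and> fps_nth (eval_at Q' u) 0 \<noteq> 0 \<and>
      eval_at P u * inverse (eval_at Q u) = eval_at P' u * inverse (eval_at Q' u)"
    using assms by (auto simp: eval_at_nth_0 intro!: exI)
next
  fix y
  assume "\<exists>P' Q'. Fraction_Field.Fract P Q = Fraction_Field.Fract P' Q' \<and> fps_nth (eval_at Q' u) 0 \<noteq> 0 \<and>
      y = eval_at P' u * inverse (eval_at Q' u)"
  then obtain P' Q' where *: "Fraction_Field.Fract P Q = Fraction_Field.Fract P' Q'"
    "fps_nth (eval_at Q' u) 0 \<noteq> 0" "y = eval_at P' u * inverse (eval_at Q' u)"
    by blast
  have nz: "Q \<noteq> 0" "Q' \<noteq> 0" using Q *(2) by auto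
  have "P * Q' = P' * Q" using *(1) nz by (simp add: eq_fract)
  then have eq: "eval_at P u * eval_at Q' u = eval_at P' u * eval_at Q u"
    by (metis eval_at_mult)
  have "fps_nth (eval_at Q u) 0 \<noteq> 0" using assms by (simp add: eval_at_nth_0)
  then have inv: "eval_at Q u * inverse (eval_at Q u) = 1" "eval_at Q' u * inverse (eval_at Q' u) = 1"
    using *(2) by (simp_all add: inverse_mult_eq_1')
  show "y = eval_at P u * inverse (eval_at Q u)"
    unfolding *(3) by (rule cross_multiply[OF inv eq])
qed

lemma regular_Fract: "poly Q 1 \<noteq> 0 \<Longrightarrow> regular (Fraction_Field.Fract P Q)"
  by (auto simp: regular_def)

lemma regularE:
  assumes "regular b"
  obtains P Q where "b = Fraction_Field.Fract P Q" "poly Q 1 \<noteq> 0" "Q \<noteq> 0"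
proof -
  obtain P Q where "b = Fraction_Field.Fract P Q" "poly Q 1 \<noteq> 0"
    using assms by (auto simp: regular_def)
  moreover from this have "Q \<noteq> 0" by auto
  ultimately show thesis by (rule that)
qed

lemma eval_at_inverse:
  assumes "fps_nth u 0 = 1" "poly Q 1 \<noteq> 0"
  shows "eval_at Q u * inverse (eval_at Q u) = 1"
  using assms by (intro inverse_mult_eq_1') (simp add: eval_at_nth_0)

section \<open>Regular functions under the field operations\<close>

lemma regular_const [simp]: "regular (const c)"
  and ratfun_eval_const: "fps_nth u 0 = 1 \<Longrightarrow> ratfun_eval (const c) u = fps_const c"
  by (simp_all add: const_def regular_Fract ratfun_eval_Fract)

lemma const_1: "const 1 = 1"
  by (simp add: const_def One_fract_def one_pCons)

lemma regular_1 [simp]: "regular 1"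
  and ratfun_eval_1: "fps_nth u 0 = 1 \<Longrightarrow> ratfun_eval 1 u = 1"
  using regular_const[of 1] ratfun_eval_const[of u 1] by (simp_all add: const_1)

lemma regular_indet [simp]: "regular indet"
  and ratfun_eval_indet: "fps_nth u 0 = 1 \<Longrightarrow> ratfun_eval indet u = u"
  by (simp_all add: indet_def regular_Fract ratfun_eval_Fract)

lemma
  assumes "regular a" "regular b"
  shows regular_add: "regular (a + b)"
    and ratfun_eval_add: "fps_nth u 0 = 1 \<Longrightarrow> ratfun_eval (a + b) u = ratfun_eval a u + ratfun_eval b u"
    and regular_mult: "regular (a * b)"
    and ratfun_eval_mult: "fps_nth u 0 = 1 \<Longrightarrow> ratfun_eval (a * b) u = ratfun_eval a u * ratfun_eval b u"
proof -
  obtain P Q where a: "a = Fraction_Field.Fract P Q" "poly Q 1 \<noteq> 0" "Q \<noteq> 0" using assms(1) by (rule regularE)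
  obtain P' Q' where b: "b = Fraction_Field.Fract P' Q'" "poly Q' 1 \<noteq> 0" "Q' \<noteq> 0" using assms(2) by (rule regularE)
  have sum: "a + b = Fraction_Field.Fract (P * Q' + P' * Q) (Q * Q')"
    and prod: "a * b = Fraction_Field.Fract (P * P') (Q * Q')"
    using a b by simp_all
  show "regular (a + b)" "regular (a * b)"
    unfolding sum prod using a b by (auto intro: regular_Fract)
  assume u: "fps_nth u 0 = 1"
  show "ratfun_eval (a * b) u = ratfun_eval a u * ratfun_eval b u"
    unfolding prod using a b u by (simp add: ratfun_eval_Fract fps_inverse_mult mult_ac)
  have inv: "eval_at Q u * inverse (eval_at Q u) = 1" "eval_at Q' u * inverse (eval_at Q' u) = 1"
    using eval_at_inverse u a b by auto
  have "ratfun_eval (a + b) u =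
      eval_at P u * inverse (eval_at Q u) * (eval_at Q' u * inverse (eval_at Q' u)) +
      eval_at P' u * inverse (eval_at Q' u) * (eval_at Q u * inverse (eval_at Q u))"
    unfolding sum using a b u
    by (simp add: ratfun_eval_Fract fps_inverse_mult algebra_simps)
  then show "ratfun_eval (a + b) u = ratfun_eval a u + ratfun_eval b u"
    unfolding inv unfolding a b using a b u by (simp add: ratfun_eval_Fract)
qed

lemma
  assumes "regular a"
  shows regular_uminus: "regular (- a)"
    and ratfun_eval_uminus: "fps_nth u 0 = 1 \<Longrightarrow> ratfun_eval (- a) u = - ratfun_eval a u"
proof -
  have eq: "- a = const (- 1) * a"
    by (cases a) (simp add: const_def)
  show "regular (- a)"
    unfolding eq using assms by (intro regular_mult) auto
  assume u: "fps_nth u 0 = 1"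
  have "fps_const (- 1) * f = - f" for f :: "complex fps"
    by (rule fps_ext) simp
  then show "ratfun_eval (- a) u = - ratfun_eval a u"
    unfolding eq using assms u by (simp only: ratfun_eval_mult ratfun_eval_const regular_const)
qed

lemma
  assumes "regular a" "regular b"
  shows regular_diff: "regular (a - b)"
    and ratfun_eval_diff: "fps_nth u 0 = 1 \<Longrightarrow> ratfun_eval (a - b) u = ratfun_eval a u - ratfun_eval b u"
  using regular_add[of a "- b"] ratfun_eval_add[of a "- b" u] assms
  by (simp_all add: regular_uminus ratfun_eval_uminus)

text \<open>The expansion has constant term \<open>P(1) / Q(1)\<close>; if it is nonzero, the
  reciprocal fraction has a denominator that does not vanish at 1.\<close>

lemma
  assumes "regular a" "fps_nth (ratfun_eval a (1 + fps_X)) 0 \<noteq> 0"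
  shows regular_inverse: "regular (inverse a)"
    and ratfun_eval_inverse:
      "fps_nth u 0 = 1 \<Longrightarrow> ratfun_eval (inverse a) u = inverse (ratfun_eval a u)"
proof -
  obtain P Q where a: "a = Fraction_Field.Fract P Q" "poly Q 1 \<noteq> 0" "Q \<noteq> 0" using assms(1) by (rule regularE)
  have P: "poly P 1 \<noteq> 0" using assms(2) a by (auto simp: ratfun_eval_Fract eval_at_nth_0)
  then have inv: "inverse a = Fraction_Field.Fract Q P" using a by simp
  show "regular (inverse a)" unfolding inv using P by (rule regular_Fract)
  assume u: "fps_nth u 0 = 1"
  show "ratfun_eval (inverse a) u = inverse (ratfun_eval a u)"
    unfolding inv unfolding a using a P u
    by (simp add: ratfun_eval_Fract fps_inverse_mult eval_at_nth_0 fps_inverse_idempotent mult.commute)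
qed

text \<open>Composition with a series without constant term is a ring homomorphism that preserves
  inverses of units. Thus the one expansion at 1 controls the values at all
  \<open>1 + y\<close>.\<close>

lemma ratfun_eval_compose:
  assumes "regular b" "fps_nth y 0 = 0"
  shows "ratfun_eval b (1 + y) = ratfun_eval b (1 + fps_X) oo y"
proof -
  obtain P Q where b: "b = Fraction_Field.Fract P Q" "poly Q 1 \<noteq> 0" "Q \<noteq> 0" using assms(1) by (rule regularE)
  have y: "1 + y = (1 + fps_X) oo y" using assms(2) by (simp add: fps_compose_add_distrib)
  have "ratfun_eval b (1 + y) = eval_at P (1 + y) * inverse (eval_at Q (1 + y))"
    using b assms by (simp add: ratfun_eval_Fract)
  also have "\<dots> = (eval_at P (1 + fps_X) oo y) * inverse (eval_at Q (1 + fps_X) oo y)"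
    unfolding y using assms(2) by (simp add: eval_at_compose)
  also have "\<dots> = (eval_at P (1 + fps_X) * inverse (eval_at Q (1 + fps_X))) oo y"
    using b assms(2) by (simp add: fps_compose_mult_distrib fps_inverse_compose eval_at_nth_0)
  finally show ?thesis using b by (simp add: ratfun_eval_Fract)
qed

text \<open>The denominator expands to a unit, so the numerator expands to zero and therefore
  vanishes.\<close>

lemma ratfun_eval_eq_0:
  assumes "regular b" "ratfun_eval b (1 + fps_X) = 0"
  shows "b = 0"
proof -
  obtain P Q where b: "b = Fraction_Field.Fract P Q" "poly Q 1 \<noteq> 0" "Q \<noteq> 0" using assms(1) by (rule regularE)
  have "inverse (eval_at Q (1 + fps_X)) \<noteq> 0"
    using eval_at_inverse[OF _ b(2), of "1 + fps_X"] by (metis fps_X_nth add.right_neutral fps_add_nth fps_one_nth mult_zero_right zero_neq_one)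
  then have "eval_at P (1 + fps_X) = 0" using assms(2) b by (simp add: ratfun_eval_Fract)
  then have "P = 0" by (simp add: eval_at_eq_0_iff)
  then show ?thesis using b by (simp add: Zero_fract_def eq_fract)
qed

section \<open>The coefficient rings\<close>

lemma const_add: "const (a + b) = const a + const b"
  and const_mult: "const (a * b) = const a * const b"
  and const_uminus: "const (- a) = - const a"
  by (simp_all add: const_def mult.commute)

lemma const_of_nat: "const (of_nat k) = of_nat k"
  by (induction k) (simp_all add: const_add const_1, simp add: const_def Zero_fract_def)

lemma const_power: "const (a ^ k) = const a ^ k"
  by (induction k) (simp_all add: const_1 const_mult)

lemma const_mem:
  assumes "subring_set A" "const z \<in> A" "a \<in> generate_ring ring_of_type_algebra {z}"
  shows "const a \<in> A"
proof -
  interpret subring_set A by fact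
  have "subring_set {a. const a \<in> A}"
    by unfold_locales (auto simp: const_1 const_add const_mult const_uminus)
  then have "generate_ring ring_of_type_algebra {z} \<subseteq> {a. const a \<in> A}"
    by (rule generate_ring_subset) (use assms in simp)
  then show ?thesis using assms(3) by auto
qed

lemma indet_nonzero [simp]: "indet \<noteq> 0"
  by (simp add: indet_def Zero_fract_def eq_fract)

lemma laurent_eval_mem:
  assumes "subring_set A" "x \<in> A" "inverse x \<in> A"
  shows "laurent_eval P x \<in> A"
proof -
  interpret subring_set A by fact
  show ?thesis
    unfolding laurent_eval_def using assms by (intro sum_mem mult_mem) (auto simp: power_int_def)
qed

lemma laurent_eval_indet_mem:
  assumes "subring_set A" "indet \<in> A" "inverse indet \<in> A"
  shows "laurent_eval P (indet ^ m) \<in> A"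
proof -
  interpret subring_set A by fact
  show ?thesis using assms by (intro laurent_eval_mem) (simp_all add: power_inverse[symmetric])
qed

lemma ratfun_eval_of_nat: "fps_nth u 0 = 1 \<Longrightarrow> ratfun_eval (of_nat k) u = of_nat k"
  using ratfun_eval_const[of u "of_nat k"] by (simp add: const_of_nat fps_of_nat)

abbreviation taylor :: "ratfun \<Rightarrow> complex fps" where
  "taylor b \<equiv> ratfun_eval b (1 + fps_X)"

text \<open>At the point 1 every power of the indeterminate takes the value 1, whatever
  \<open>m\<close> is, so only the sum of the coefficients of \<open>P\<close> remains. For \<Delta>
  this makes \<open>1/\<Delta>\<close> expandable without denominators.\<close>

lemma augmentation_laurent_eval:
  "regular (laurent_eval P (indet ^ m)) \<and>
   fps_nth (taylor (laurent_eval P (indet ^ m))) 0 = laurent_eval P 1"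
proof -
  have reg_inv: "regular (inverse indet)"
    by (rule regular_inverse) (simp_all add: ratfun_eval_indet)
  have inv: "taylor (inverse indet) = inverse (1 + fps_X)"
    by (subst ratfun_eval_inverse) (simp_all add: ratfun_eval_indet)
  have pow: "regular (x ^ k) \<and> fps_nth (taylor (x ^ k)) 0 = 1"
    if "regular x" "fps_nth (taylor x) 0 = 1" for x k
    by (induction k) (use that in \<open>auto simp: ratfun_eval_1 ratfun_eval_mult intro: regular_mult\<close>)
  have powi: "regular ((indet ^ m) powi i) \<and> fps_nth (taylor ((indet ^ m) powi i)) 0 = 1" for i
    unfolding power_int_def
    using pow[of "indet ^ m" "nat i"] pow[of "inverse indet ^ m" "nat (- i)"]
      pow[of indet m] pow[of "inverse indet" m] inv reg_inv
    by (simp add: ratfun_eval_indet power_inverse)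
  have int: "regular (of_int k) \<and> fps_nth (taylor (of_int k)) 0 = of_int k" for k
    using regular_const[of "of_nat (nat k)"] regular_const[of "of_nat (nat (- k))"]
    by (cases k) (simp_all add: const_of_nat ratfun_eval_of_nat regular_uminus ratfun_eval_uminus
        flip: of_nat_Suc fps_of_nat del: of_nat_Suc)
  have "regular (\<Sum>i\<in>I. of_int (c i) * (indet ^ m) powi i) \<and>
    fps_nth (taylor (\<Sum>i\<in>I. of_int (c i) * (indet ^ m) powi i)) 0 = (\<Sum>i\<in>I. of_int (c i))"
    if "finite I" for I and c :: "int \<Rightarrow> int"
    using that
  proof induction
    case empty
    then show ?case using int[of 0] by simp
  next
    case (insert i I)
    then show ?case using powi[of i] int[of "c i"]
      by (auto simp: ratfun_eval_add ratfun_eval_mult regular_add regular_mult)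
  qed
  then show ?thesis by (simp add: laurent_eval_def)
qed

text \<open>The recursion for the coefficients of the inverse divides only by the constant term,
  which is 1.\<close>

lemma fps_inverse_coeffs_mem:
  assumes "subring_set A" "fps_nth f 0 = (1 :: complex)" "\<And>k. fps_nth f k \<in> A"
  shows "fps_nth (inverse f) k \<in> A"
proof (induction k rule: less_induct)
  case (less n)
  interpret subring_set A by fact
  show ?case
  proof (cases "n = 0")
    case False
    have "fps_nth (f * inverse f) n = 0"
      using assms(2) False by (subst inverse_mult_eq_1') auto
    then have "(\<Sum>i=0..n. fps_nth f i * fps_nth (inverse f) (n - i)) = 0"
      by (simp add: fps_mult_nth)
    then have "fps_nth (inverse f) n = - (\<Sum>i=Suc 0..n. fps_nth f i * fps_nth (inverse f) (n - i))"
      using assms(2) by (simp add: sum.atLeast_Suc_atMost eq_neg_iff_add_eq_0)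
    moreover have "(\<Sum>i=Suc 0..n. fps_nth f i * fps_nth (inverse f) (n - i)) \<in> A"
      using assms less False by (intro sum_mem mult_mem) auto
    ultimately show ?thesis by simp
  qed (use assms in simp)
qed

text \<open>The functions with both properties form a subring closed under inverting elements whose
  expansion starts with 1. The indeterminate is such an element, and so is \<Delta> because of its
  value 1 at \<open>t = 1\<close>.\<close>

lemma coeff_ring_taylor:
  assumes "laurent_eval \<Delta> (1 :: complex) = 1" and b: "b \<in> coeff_ring \<Delta> z m"
  shows "regular b" "fps_nth (taylor b) k \<in> generate_ring ring_of_type_algebra {z}"
proof -
  let ?O = "generate_ring ring_of_type_algebra {z}"
  interpret O: subring_set ?O by (rule subring_set_generate_ring)
  define S where "S = {b. regular b \<and> (\<forall>k. fps_nth (taylor b) k \<in> ?O)}"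
  have S: "subring_set S"
  proof
    fix x y assume "x \<in> S" "y \<in> S"
    then show "x + y \<in> S" "x * y \<in> S"
      by (auto simp: S_def ratfun_eval_add ratfun_eval_mult fps_mult_nth
          intro: regular_add regular_mult O.sum_mem)
  qed (auto simp: S_def ratfun_eval_1 ratfun_eval_uminus intro: regular_uminus)
  interpret S: subring_set S by (rule S)
  have inv: "inverse x \<in> S" if "x \<in> S" "fps_nth (taylor x) 0 = 1" for x
    using that fps_inverse_coeffs_mem[OF O.subring_set_axioms, of "taylor x"]
    by (auto simp: S_def ratfun_eval_inverse intro: regular_inverse)
  have "const z \<in> S"
    by (auto simp: S_def ratfun_eval_const intro: generate_ring.incl)
  moreover have indet: "indet \<in> S"
    by (auto simp: S_def ratfun_eval_indet)
  moreover have inv_indet: "inverse indet \<in> S"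
    by (rule inv[OF indet]) (simp add: ratfun_eval_indet)
  moreover have "inverse (laurent_eval \<Delta> (indet ^ m)) \<in> S"
    using augmentation_laurent_eval[of \<Delta> m] assms(1)
    by (intro inv laurent_eval_indet_mem[OF S indet inv_indet]) auto
  ultimately have "coeff_ring \<Delta> z m \<subseteq> S"
    unfolding coeff_ring_def by (intro generate_ring_subset S) auto
  with b show "regular b" "fps_nth (taylor b) k \<in> ?O" by (auto simp: S_def)
qed

lemma subring_set_coeff_ring: "subring_set (coeff_ring \<Delta> z m)"
  unfolding coeff_ring_def by (rule subring_set_generate_ring)

text \<open>Divisibility by \<open>p ^ n\<close> passes to every Taylor coefficient. These lie in
  the separated ring generated by \<open>z\<close>, so the expansion vanishes, and with it the
  function.\<close>

lemma coeff_ring_separated: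
  assumes \<Delta>: "laurent_eval \<Delta> (1 :: complex) = 1" and z: "z ^ M = 1" "M > 0" and "p > 1"
  shows "subring_set.padically_separated (coeff_ring \<Delta> z m) p"
proof -
  let ?O = "generate_ring ring_of_type_algebra {z}"
  interpret O: subring_set ?O by (rule subring_set_generate_ring)
  interpret A: subring_set "coeff_ring \<Delta> z m" by (rule subring_set_coeff_ring)
  show ?thesis
    unfolding A.padically_separated_def
  proof (intro allI impI)
    fix a assume a: "\<forall>n. a \<in> A.multiples (of_nat (p ^ n))"
    then have aA: "a \<in> coeff_ring \<Delta> z m"
      using a[rule_format, of 0] A.multiples_subset[of 1] by auto
    have "fps_nth (taylor a) k \<in> O.multiples (of_nat (p ^ n))" for k n
    proof -
      obtain r where r: "r \<in> coeff_ring \<Delta> z m" "a = r * of_nat (p ^ n)"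
        using a[rule_format, of n] unfolding A.multiples_iff by blast
      have "regular (of_nat (p ^ n))"
        using regular_const[of "of_nat (p ^ n)"] by (simp only: const_of_nat)
      then have "taylor a = taylor r * of_nat (p ^ n)"
        unfolding r(2) using coeff_ring_taylor(1)[OF \<Delta> r(1)]
        by (subst ratfun_eval_mult) (simp_all add: ratfun_eval_of_nat del: of_nat_power)
      then have "fps_nth (taylor a) k = fps_nth (taylor r) k * of_nat (p ^ n)"
        by (simp only: fps_of_nat[symmetric] fps_mult_right_const_nth)
      then show ?thesis
        unfolding O.multiples_iff using coeff_ring_taylor(2)[OF \<Delta> r(1)] by blast
    qed
    then have "taylor a = 0"
      using padically_separated_generated_by_root_of_unity[OF z \<open>p > 1\<close>]
      by (intro fps_ext) (simp add: O.padically_separated_def)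
    then show "a = 0"
      using ratfun_eval_eq_0 coeff_ring_taylor(1)[OF \<Delta> aA] by blast
  qed
qed

text \<open>The lowest-order homogeneous part \<open>\<Sum>\<^sub>k c\<^sub>k x\<^sup>k y\<^bsup>d-k\<^esup>\<close> of \<open>\<Sum>\<^sub>k h\<^sub>k(y) x\<^sup>k\<close> becomes
  \<open>x\<^sup>d \<Sum>\<^sub>k c\<^sub>k r\<^bsup>d-k\<^esup>\<close> for \<open>y = (1 + x)\<^sup>r - 1 = r x + O(x\<^sup>2)\<close>, a polynomial in \<open>r\<close> with infinitely many
  zeros.\<close>

lemma fps_eq_0_if_vanishing_on_curves:
  fixes h :: "nat \<Rightarrow> complex fps"
  assumes "\<And>r N. (\<Sum>k\<le>N. fps_nth (h k oo ((1 + fps_X) ^ r - 1)) (N - k)) = 0"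
  shows "h k = 0"
proof -
  \<comment> \<open>Induction on the total degree \<open>d\<close>: the coefficient of index
    \<open>d - k\<close> in \<open>h k\<close> belongs to the homogeneous part of degree
    \<open>d\<close> of the two-variable series.\<close>
  have "\<forall>k\<le>d. fps_nth (h k) (d - k) = 0" for d
  proof (induction d rule: less_induct)
    case (less d)
    \<comment> \<open>Lower coefficients of \<open>h k\<close> vanish by induction, so only the
      leading term \<open>(r x) ^ (d - k)\<close> of the power of \<open>y\<close>
      contributes.\<close>
    have nth: "fps_nth (h k oo ((1 + fps_X) ^ r - 1)) (d - k) = fps_nth (h k) (d - k) * of_nat r ^ (d - k)"
      if "k \<le> d" for k r
    proof -
      define y :: "complex fps" where "y = (1 + fps_X) ^ r - 1"
      have y0: "fps_nth y 0 = 0" by (simp add: y_def fps_nth_power_0)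
      have y1: "fps_nth y 1 = of_nat r"
        unfolding y_def by (induction r) (simp_all add: algebra_simps fps_nth_power_0)
      have "fps_nth (h k) i = 0" if "i < d - k" for i
        using less[rule_format, of "i + k" k] that by (simp add: less_diff_conv)
      then have "fps_nth (h k oo y) (d - k) = fps_nth (h k) (d - k) * fps_nth (y ^ (d - k)) (d - k)"
        by (subst fps_compose_nth, subst sum.remove[of _ "d - k"]) auto
      then show ?thesis
        using startsby_zero_power_nth_same[OF y0, of "d - k"] y1 by (simp add: y_def)
    qed
    \<comment> \<open>The coefficient of \<open>x ^ d\<close> on the curve, as a polynomial in
      \<open>r\<close>. The exponents \<open>d - k\<close> are distinct, so the unknown coefficients
      can be read off from \<open>P = 0\<close>.\<close>
    define P where "P = (\<Sum>k\<le>d. Polynomial.monom (fps_nth (h k) (d - k)) (d - k))"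
    have "poly P (of_nat r) = 0" for r
      using assms[where r = r and N = d] nth[of _ r] by (simp add: P_def poly_sum poly_monom)
    then have "range of_nat \<subseteq> {x. poly P x = 0}" by auto
    moreover have "infinite (range (of_nat :: nat \<Rightarrow> complex))"
      by (rule range_inj_infinite) (simp add: inj_of_nat)
    ultimately have "P = 0" using poly_roots_finite finite_subset by blast
    show ?case
    proof (intro allI impI)
      fix k assume "k \<le> d"
      have "Polynomial.coeff P (d - k) =
        (\<Sum>j\<le>d. if j = k then fps_nth (h j) (d - j) else 0)"
        unfolding P_def coeff_sum by (intro sum.cong) (use \<open>k \<le> d\<close> in auto)
      also have "\<dots> = fps_nth (h k) (d - k)" using \<open>k \<le> d\<close> by simp
      finally show "fps_nth (h k) (d - k) = 0" using \<open>P = 0\<close> by simp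
    qed
  qed
  from this[of "k + i" for i] show ?thesis
    by (intro fps_ext) (metis add_diff_cancel_left' fps_zero_nth le_add1)
qed

text \<open>Expanding the coefficients of the difference at \<open>t = 1 + y\<close> gives a series
  in \<open>y\<close> and \<open>x = q - 1\<close>. Setting \<open>t = q ^ r\<close> restricts it to
  the curve \<open>y = (1 + x) ^ r - 1\<close>, and a series vanishing on all these curves is
  zero.\<close>

lemma specialize_inject:
  assumes reg: "\<And>k. regular (fps_nth f k)" "\<And>k. regular (fps_nth g k)"
    and eq: "\<And>r. specialize 1 (int r) f = specialize 1 (int r) g"
  shows "f = g"
proof -
  define h where "h = (\<lambda>k. taylor (fps_nth f k - fps_nth g k))"
  have "(\<Sum>k\<le>N. fps_nth (h k oo ((1 + fps_X) ^ r - 1)) (N - k)) = 0" for r N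
  proof -
    define y :: "complex fps" where "y = (1 + fps_X) ^ r - 1"
    have y: "fps_nth y 0 = 0" "q_at 1 powi int r = 1 + y"
      by (simp_all add: y_def q_at_def fps_nth_power_0 flip: fps_const_1_eq_1)
    have "h k oo y = ratfun_eval (fps_nth f k) (1 + y) - ratfun_eval (fps_nth g k) (1 + y)" for k
    proof -
      have "h k oo y = ratfun_eval (fps_nth f k - fps_nth g k) (1 + y)"
        unfolding h_def using reg y by (intro ratfun_eval_compose[symmetric] regular_diff)
      then show ?thesis using reg y by (simp add: ratfun_eval_diff)
    qed
    then have "(\<Sum>k\<le>N. fps_nth (h k oo y) (N - k)) =
      fps_nth (specialize 1 (int r) f) N - fps_nth (specialize 1 (int r) g) N"
      unfolding specialize_def y(2) by (simp add: sum_subtractf)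
    then show ?thesis by (simp add: eq y_def)
  qed
  then have "h k = 0" for k by (rule fps_eq_0_if_vanishing_on_curves)
  then have "fps_nth f k - fps_nth g k = 0" for k
    using ratfun_eval_eq_0[OF regular_diff[OF reg]] by (simp add: h_def)
  then show ?thesis by (intro fps_ext) simp
qed

section \<open>The Frobenius\<close>

lemma ring_hom_subring_set:
  assumes "f \<in> Ring.ring_hom (ring_on A) R" "subring_set A" "subring_set B" "B \<subseteq> A"
  shows "f \<in> Ring.ring_hom (ring_on B) R"
proof -
  interpret A: subring_set A by fact
  interpret B: subring_set B by fact
  show ?thesis using assms(1,4) unfolding Ring.ring_hom_def by (simp add: Pi_def) blast
qed

text \<open>Uniqueness of inverses carries agreement of two homomorphisms from a unit to its
  inverse. This is what handles the inverted generators of the coefficient rings.\<close>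

lemma
  assumes "subring_set A" "cring R" "f \<in> Ring.ring_hom (ring_on A) R" "g \<in> Ring.ring_hom (ring_on A) R"
  shows subring_set_equalizer: "subring_set {a \<in> A. f a = g a}"
    and equalizer_unit: "a \<in> A \<Longrightarrow> b \<in> A \<Longrightarrow> a * b = 1 \<Longrightarrow> f a = g a \<Longrightarrow> f b = g b"
proof -
  interpret A: subring_set A by fact
  interpret R: cring R by fact
  interpret f: ring_hom_cring "ring_on A" R f
    using assms by (intro ring_hom_cringI ring_hom_ringI2 A.cring_ring_on cring.axioms(1))
  interpret g: ring_hom_cring "ring_on A" R g
    using assms by (intro ring_hom_cringI ring_hom_ringI2 A.cring_ring_on cring.axioms(1))
  have closed: "f a \<in> carrier R" "g a \<in> carrier R" if "a \<in> A" for a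
    using f.hom_closed[of a] g.hom_closed[of a] that by auto
  have mult: "f (a * b) = f a \<otimes>\<^bsub>R\<^esub> f b" "g (a * b) = g a \<otimes>\<^bsub>R\<^esub> g b" if "a \<in> A" "b \<in> A" for a b
    using f.hom_mult[of a b] g.hom_mult[of a b] that by auto
  have add: "f (a + b) = f a \<oplus>\<^bsub>R\<^esub> f b" "g (a + b) = g a \<oplus>\<^bsub>R\<^esub> g b" if "a \<in> A" "b \<in> A" for a b
    using f.hom_add[of a b] g.hom_add[of a b] that by auto
  have one: "f 1 = \<one>\<^bsub>R\<^esub>" "g 1 = \<one>\<^bsub>R\<^esub>" and zero: "f 0 = \<zero>\<^bsub>R\<^esub>" "g 0 = \<zero>\<^bsub>R\<^esub>"
    using f.hom_one g.hom_one f.hom_zero g.hom_zero by auto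
  show "subring_set {a \<in> A. f a = g a}"
  proof (unfold_locales, goal_cases)
    case (2 x)
    then have x: "x \<in> A" "f x = g x" by auto
    have "f (- x) \<oplus>\<^bsub>R\<^esub> f x = \<zero>\<^bsub>R\<^esub>" "g (- x) \<oplus>\<^bsub>R\<^esub> f x = \<zero>\<^bsub>R\<^esub>"
      using x add[of "- x" x] zero by simp_all
    then have "f (- x) = g (- x)"
      using closed x by (metis A.uminus_mem R.minus_equality)
    with x show ?case by simp
  qed (auto simp: one mult add)
  assume "a \<in> A" "b \<in> A" "a * b = 1" "f a = g a"
  then have "f b \<otimes>\<^bsub>R\<^esub> f a = \<one>\<^bsub>R\<^esub>" "f a \<otimes>\<^bsub>R\<^esub> g b = \<one>\<^bsub>R\<^esub>"
    using mult[of a b] one closed R.m_comm[of "f a" "f b"] by auto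
  then show "f b = g b"
    by (rule R.inv_unique) (simp_all add: closed \<open>a \<in> A\<close> \<open>b \<in> A\<close>)
qed

lemma padic_component_hom:
  "(\<lambda>x. x n) \<in> Ring.ring_hom (padic_completion p A) (mod_pow p A n)"
  by (rule ring_hom_memI) (auto simp: padic_completion_def)

text \<open>Working at each level \<open>n\<close> separately replaces the completion by the
  commutative rings \<open>mod_pow p A n\<close>, to which the equalizer argument applies.\<close>

lemma completion_hom_component:
  assumes "\<phi> \<in> Ring.ring_hom (padic_completion p A') (padic_completion p A)" "subring_set A'"
  shows "(\<lambda>a. \<phi> (to_completion p A' a) n) \<in> Ring.ring_hom (ring_on A') (mod_pow p A n)"
  using ring_hom_trans[OF ring_hom_trans[OF subring_set.to_completion_ring_hom[OF assms(2)] assms(1)]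
      padic_component_hom, of n]
  by (simp add: comp_def)

lemma coeff_ring_generators:
  "const z \<in> coeff_ring \<Delta> z m" "indet \<in> coeff_ring \<Delta> z m" "inverse indet \<in> coeff_ring \<Delta> z m"
  "inverse (laurent_eval \<Delta> (indet ^ m)) \<in> coeff_ring \<Delta> z m"
  by (auto simp: coeff_ring_def intro: generate_ring.incl)

lemma frobeniusD:
  assumes "frobenius \<zeta> \<Delta> p m \<phi>"
  defines "A' \<equiv> coeff_ring \<Delta> (\<zeta> (p * m)) (p * m)" and "A \<equiv> coeff_ring \<Delta> (\<zeta> (p * m)) m"
  shows "\<phi> \<in> Ring.ring_hom (padic_completion p A') (padic_completion p A)"
    "\<phi> (to_completion p A' indet) = to_completion p A indet"
    "\<phi> (to_completion p A' (const (\<zeta> (p * m)))) = to_completion p A (const (\<zeta> (p * m)))"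
  using assms(1) by (auto simp: frobenius_def Let_def A'_def A_def)

text \<open>The maps agree on \<open>const\<close> of the root and on \<open>indet\<close>, hence on
  inverses and on the generated ring. Each instance of \<open>glued\<close> brings its own \<phi>;
  this makes them interchangeable on the uncompleted ring, where \<open>glued\<close> evaluates
  them.\<close>

lemma frobenius_unique:
  assumes \<phi>: "frobenius \<zeta> \<Delta> p m \<phi>" "frobenius \<zeta> \<Delta> p m \<phi>'"
    and a: "a \<in> coeff_ring \<Delta> (\<zeta> (p * m)) (p * m)"
    and \<Delta>: "laurent_eval \<Delta> (1 :: complex) = 1"
  shows "\<phi> (to_completion p (coeff_ring \<Delta> (\<zeta> (p * m)) (p * m)) a) =
    \<phi>' (to_completion p (coeff_ring \<Delta> (\<zeta> (p * m)) (p * m)) a)"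
proof
  fix n
  define A' A where "A' = coeff_ring \<Delta> (\<zeta> (p * m)) (p * m)" and "A = coeff_ring \<Delta> (\<zeta> (p * m)) m"
  note D = frobeniusD[OF \<phi>(1), folded A'_def A_def] frobeniusD[OF \<phi>(2), folded A'_def A_def]
  interpret A': subring_set A' unfolding A'_def by (rule subring_set_coeff_ring)
  interpret A: subring_set A unfolding A_def by (rule subring_set_coeff_ring)
  let ?f = "\<lambda>a. \<phi> (to_completion p A' a) n" and ?g = "\<lambda>a. \<phi>' (to_completion p A' a) n"
  have hom: "?f \<in> Ring.ring_hom (ring_on A') (mod_pow p A n)" "?g \<in> Ring.ring_hom (ring_on A') (mod_pow p A n)"
    using D A'.subring_set_axioms by (auto intro: completion_hom_component)
  define E where "E = {a \<in> A'. ?f a = ?g a}"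
  have E: "subring_set E"
    unfolding E_def by (rule subring_set_equalizer[OF A'.subring_set_axioms A.cring_mod_pow hom])
  have unit: "b \<in> E" if "a \<in> E" "b \<in> A'" "a * b = 1" for a b
    using equalizer_unit[OF A'.subring_set_axioms A.cring_mod_pow hom, of a b] that by (auto simp: E_def)
  note gen = coeff_ring_generators[where \<Delta> = \<Delta> and z = "\<zeta> (p * m)" and m = "p * m", folded A'_def]
  have z: "const (\<zeta> (p * m)) \<in> E" and indet: "indet \<in> E"
    using D gen by (auto simp: E_def)
  have inv_indet: "inverse indet \<in> E"
    by (rule unit[OF indet]) (use gen in auto)
  have eval: "laurent_eval \<Delta> (indet ^ (p * m)) \<in> E"
    by (rule laurent_eval_indet_mem[OF E indet inv_indet])
  \<comment> \<open>The value 1 at \<open>t = 1\<close> excludes zero, so the generator is a true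
    inverse and not the default \<open>inverse 0 = 0\<close>.\<close>
  have "laurent_eval \<Delta> (indet ^ (p * m)) \<noteq> 0"
    using augmentation_laurent_eval[of \<Delta> "p * m"] \<Delta> ratfun_eval_const[of "1 + fps_X" 0]
    by (auto simp: const_def Zero_fract_def)
  then have "inverse (laurent_eval \<Delta> (indet ^ (p * m))) \<in> E"
    by (intro unit[OF eval]) (use gen in auto)
  then have "A' \<subseteq> E"
    unfolding A'_def coeff_ring_def using z indet inv_indet by (intro generate_ring_subset E) auto
  with a show "\<phi> (to_completion p A' a) n = \<phi>' (to_completion p A' a) n"
    by (auto simp: A'_def E_def)
qed

text \<open>Fractions over \<open>B\<close> are closed under inversion: if \<open>s * x\<close> lies
  in \<open>B\<close> and is nonzero, it serves as denominator of \<open>inverse x\<close>, with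
  numerator \<open>s\<close>. The case \<open>x = 0\<close> is covered by
  \<open>inverse 0 = 0\<close>.\<close>

lemma coeff_ring_denominator:
  assumes "a \<in> coeff_ring \<Delta> z m"
  defines "B \<equiv> generate_ring ring_of_type_algebra {const z, indet}"
  shows "\<exists>s\<in>B. s \<noteq> 0 \<and> s * a \<in> B"
proof -
  interpret B: subring_set B unfolding B_def by (rule subring_set_generate_ring)
  define D where "D = {a. \<exists>s\<in>B. s \<noteq> 0 \<and> s * a \<in> B}"
  have B_D: "B \<subseteq> D" by (auto simp: D_def intro: bexI[of _ 1])
  have D: "subring_set D"
  proof
    show "1 \<in> D" using B_D by auto
    show "- x \<in> D" if "x \<in> D" for x
      using that B.uminus_mem unfolding D_def by fastforce
    fix x y assume "x \<in> D" "y \<in> D"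
    then obtain s t where st: "s \<in> B" "s \<noteq> 0" "s * x \<in> B" "t \<in> B" "t \<noteq> 0" "t * y \<in> B"
      by (auto simp: D_def)
    have "(s * t) * (x + y) = t * (s * x) + s * (t * y)" by (simp add: algebra_simps)
    then have "(s * t) * (x + y) \<in> B" using st by (simp only: B.add_mem B.mult_mem)
    then show "x + y \<in> D" using st unfolding D_def by (auto intro!: bexI[of _ "s * t"])
    have "(s * t) * (x * y) = (s * x) * (t * y)" by (simp add: algebra_simps)
    then have "(s * t) * (x * y) \<in> B" using st by (simp only: B.mult_mem)
    then show "x * y \<in> D" using st unfolding D_def by (auto intro!: bexI[of _ "s * t"])
  qed
  have inv: "inverse x \<in> D" if "x \<in> D" for x
  proof (cases "x = 0")
    case False
    obtain s where "s \<in> B" "s \<noteq> 0" "s * x \<in> B" using \<open>x \<in> D\<close> by (auto simp: D_def)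
    moreover have "s * x * inverse x = s" using False by simp
    ultimately have "s * x \<in> B \<and> s * x \<noteq> 0 \<and> s * x * inverse x \<in> B"
      using False by (simp only: mult_eq_0_iff) simp
    then show ?thesis unfolding D_def by blast
  qed (use that in simp)
  have "const z \<in> D" and indet: "indet \<in> D"
    using B_D by (auto simp: B_def intro: generate_ring.incl)
  moreover from indet have "inverse indet \<in> D" by (rule inv)
  ultimately have "coeff_ring \<Delta> z m \<subseteq> D"
    unfolding coeff_ring_def
    by (intro generate_ring_subset D) (auto intro!: inv laurent_eval_indet_mem[OF D])
  then show ?thesis using assms(1) by (auto simp: D_def)
qed

text \<open>A common denominator \<open>s * t\<close> moves \<open>a\<close> and \<open>b\<close>
  into \<open>B\<close>, where \<phi> acts as the identity on representatives; separatedness of the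
  target then yields equality.\<close>

lemma frobenius_inject:
  assumes \<phi>: "frobenius \<zeta> \<Delta> p m \<phi>"
    and a: "a \<in> coeff_ring \<Delta> (\<zeta> (p * m)) (p * m)" "b \<in> coeff_ring \<Delta> (\<zeta> (p * m)) (p * m)"
    and sep: "subring_set.padically_separated (coeff_ring \<Delta> (\<zeta> (p * m)) m) p"
    and eq: "\<phi> (to_completion p (coeff_ring \<Delta> (\<zeta> (p * m)) (p * m)) a) =
      \<phi> (to_completion p (coeff_ring \<Delta> (\<zeta> (p * m)) (p * m)) b)"
  shows "a = b"
proof -
  define A' A where "A' = coeff_ring \<Delta> (\<zeta> (p * m)) (p * m)" and "A = coeff_ring \<Delta> (\<zeta> (p * m)) m"
  define B where "B = generate_ring ring_of_type_algebra {const (\<zeta> (p * m)), indet}"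
  note D = frobeniusD[OF \<phi>, folded A'_def A_def]
  interpret A': subring_set A' unfolding A'_def by (rule subring_set_coeff_ring)
  interpret A: subring_set A unfolding A_def by (rule subring_set_coeff_ring)
  interpret B: subring_set B unfolding B_def by (rule subring_set_generate_ring)
  have B_sub: "B \<subseteq> A'" "B \<subseteq> A"
    unfolding B_def A'_def A_def
    by (intro generate_ring_subset subring_set_coeff_ring; simp add: coeff_ring_generators)+
  let ?f = "\<lambda>n a. \<phi> (to_completion p A' a) n"
  have f_hom: "?f n \<in> Ring.ring_hom (ring_on A') (mod_pow p A n)" for n
    using D(1) A'.subring_set_axioms by (rule completion_hom_component)
  \<comment> \<open>The Frobenius looks like the identity because the indeterminate changes its
    meaning, from \<open>t^(1/(pm))\<close> in the source to \<open>t^(1/m)\<close> in the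
    target.\<close>
  have on_B: "?f n c = to_completion p A c n" if "c \<in> B" for c n
  proof -
    let ?E = "{c \<in> B. ?f n c = to_completion p A c n}"
    have "?f n \<in> Ring.ring_hom (ring_on B) (mod_pow p A n)"
      by (rule ring_hom_subring_set[OF f_hom A'.subring_set_axioms B.subring_set_axioms B_sub(1)])
    moreover have "(\<lambda>c. to_completion p A c n) \<in> Ring.ring_hom (ring_on B) (mod_pow p A n)"
      by (rule ring_hom_subring_set[OF A.to_completion_hom A.subring_set_axioms B.subring_set_axioms B_sub(2)])
    ultimately have "subring_set ?E"
      by (rule subring_set_equalizer[OF B.subring_set_axioms A.cring_mod_pow])
    then have "B \<subseteq> ?E"
      unfolding B_def
      by (rule generate_ring_subset) (use D in \<open>auto intro: generate_ring.incl\<close>)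
    then show ?thesis using that by auto
  qed
  obtain s where s: "s \<in> B" "s \<noteq> 0" "s * a \<in> B" using coeff_ring_denominator[OF a(1)] unfolding B_def by blast
  obtain t where t: "t \<in> B" "t \<noteq> 0" "t * b \<in> B" using coeff_ring_denominator[OF a(2)] unfolding B_def by blast
  have r: "s * t \<in> A'" "s * t * a \<in> B" "s * t * b \<in> B"
  proof -
    show "s * t \<in> A'" using s t B_sub by auto
    have "s * t * a = t * (s * a)" "s * t * b = s * (t * b)" by (simp_all add: mult_ac)
    then show "s * t * a \<in> B" "s * t * b \<in> B" using s t by (simp_all only: B.mult_mem)
  qed
  have "to_completion p A (s * t * a) n = to_completion p A (s * t * b) n" for n
  proof -
    have "?f n (s * t * a) = ?f n (s * t) \<otimes>\<^bsub>mod_pow p A n\<^esub> ?f n a"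
      "?f n (s * t * b) = ?f n (s * t) \<otimes>\<^bsub>mod_pow p A n\<^esub> ?f n b"
      using ring_hom_mult[OF f_hom, of "s * t"] r(1) a by (simp_all add: A'_def[symmetric])
    then show ?thesis using eq r on_B by (simp add: A'_def)
  qed
  then have "to_completion p A (s * t * a) = to_completion p A (s * t * b)" by blast
  then have "s * t * a = s * t * b"
    by (rule A.to_completion_inject[OF sep[folded A_def]])
  then show ?thesis using s t by simp
qed

section \<open>Re-expansion\<close>

context subring_set
begin

lemma multiples_diff_trans:
  "x - y \<in> multiples c \<Longrightarrow> y - z \<in> multiples c \<Longrightarrow> x - z \<in> multiples c"
  using multiples_add[of "x - y" c "y - z"] by simp

lemma power_diff_multiples:
  assumes "x - y \<in> multiples c" "x \<in> A" "y \<in> A"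
  shows "x ^ k - y ^ k \<in> multiples c"
proof (induction k)
  case (Suc k)
  have "x ^ Suc k - y ^ Suc k = x ^ k * (x - y) + y * (x ^ k - y ^ k)"
    by (simp add: algebra_simps)
  then show ?case using Suc assms by (simp only: multiples_add multiples_mult power_mem)
qed simp

text \<open>All binomial coefficients \<open>p choose k\<close> with \<open>0 < k < p\<close> are
  divisible by \<open>p\<close>.\<close>

lemma add_power_prime:
  assumes "Factorial_Ring.prime p" "x \<in> A" "y \<in> A"
  shows "(x + y) ^ p - (x ^ p + y ^ p) \<in> multiples (of_nat p)"
proof -
  have "p > 0" using assms(1) prime_gt_0_nat by blast
  have "(x + y) ^ p = (\<Sum>k\<le>p. of_nat (p choose k) * x ^ k * y ^ (p - k))"
    by (rule binomial_ring)
  also have "{..p} = insert 0 (insert p {0<..<p})" by auto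
  also have "(\<Sum>k\<in>\<dots>. of_nat (p choose k) * x ^ k * y ^ (p - k)) =
    y ^ p + (x ^ p + (\<Sum>k\<in>{0<..<p}. of_nat (p choose k) * x ^ k * y ^ (p - k)))"
    using \<open>p > 0\<close> by simp
  finally have "(x + y) ^ p - (x ^ p + y ^ p) =
    (\<Sum>k\<in>{0<..<p}. of_nat (p choose k) * x ^ k * y ^ (p - k))" by simp
  also have "\<dots> \<in> multiples (of_nat p)"
  proof (rule multiples_sum)
    fix k assume "k \<in> {0<..<p}"
    then have "p dvd (p choose k)"
      by (intro dvd_choose_prime) (use assms(1) in auto)
    then obtain c where "p choose k = p * c" by (elim dvdE)
    then have "of_nat (p choose k) * x ^ k * y ^ (p - k) = (of_nat c * x ^ k * y ^ (p - k)) * of_nat p"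
      by (simp add: mult_ac)
    moreover have "of_nat c * x ^ k * y ^ (p - k) \<in> A" using assms by simp
    ultimately show "of_nat (p choose k) * x ^ k * y ^ (p - k) \<in> multiples (of_nat p)"
      unfolding multiples_iff by blast
  qed
  finally show ?thesis .
qed

lemma add_power_prime_power:
  assumes "Factorial_Ring.prime p" "x \<in> A" "y \<in> A"
  shows "(x + y) ^ (p ^ k) - (x ^ (p ^ k) + y ^ (p ^ k)) \<in> multiples (of_nat p)"
proof (induction k)
  case (Suc k)
  have "((x + y) ^ (p ^ k)) ^ p - (x ^ (p ^ k) + y ^ (p ^ k)) ^ p \<in> multiples (of_nat p)"
    using assms by (intro power_diff_multiples[OF Suc]) simp_all
  moreover have "(x ^ (p ^ k) + y ^ (p ^ k)) ^ p - ((x ^ (p ^ k)) ^ p + (y ^ (p ^ k)) ^ p) \<in> multiples (of_nat p)"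
    using assms by (intro add_power_prime) simp_all
  ultimately have "((x + y) ^ (p ^ k)) ^ p - ((x ^ (p ^ k)) ^ p + (y ^ (p ^ k)) ^ p) \<in> multiples (of_nat p)"
    by (rule multiples_diff_trans)
  then show ?case by (simp add: mult.commute flip: power_mult)
qed simp

lemma power_multiples:
  assumes "x \<in> multiples c" "c \<in> A"
  shows "x ^ n \<in> multiples (c ^ n)"
proof -
  obtain r where "r \<in> A" "x = r * c" using assms by (auto simp: multiples_iff)
  then show ?thesis unfolding multiples_iff by (intro bexI[of _ "r ^ n"]) (simp_all add: power_mult_distrib)
qed

text \<open>Each coefficient \<open>d\<^sub>j\<close> is congruent modulo \<open>p\<^sup>n\<close> to a multiple of \<open>u\<close> times later coefficients;
  iterating this gains arbitrarily high powers of \<open>u\<close>.\<close>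

lemma reexpansion_eq_0:
  assumes u: "u \<in> A" "u ^ M \<in> multiples (of_nat p)" and d: "\<And>k. d k \<in> A"
    and sums: "\<And>j n. \<forall>\<^sub>F N in sequentially.
      (\<Sum>k<N. of_nat ((j + k) choose j) * d (j + k) * u ^ k) \<in> multiples (of_nat (p ^ n))"
  shows "d j \<in> multiples (of_nat (p ^ n))"
proof -
  let ?I = "multiples (of_nat (p ^ n))"
  \<comment> \<open>All \<open>j\<close> are treated together, since raising \<open>s\<close> by one
    for \<open>d j\<close> uses the approximations of later coefficients.\<close>
  have "\<forall>j. \<exists>x\<in>A. d j - x * u ^ s \<in> ?I" for s
  proof (induction s)
    case 0
    have "\<exists>x\<in>A. d j - x * u ^ 0 \<in> ?I" for j
      by (rule bexI[of _ "d j"]) (simp_all add: d)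
    then show ?case by blast
  next
    case (Suc s)
    then obtain x where x: "\<And>j. x j \<in> A" "\<And>j. d j - x j * u ^ s \<in> ?I" by metis
    show ?case
    proof
      fix j
      let ?c = "\<lambda>k. of_nat ((j + k) choose j) :: 'a"
      \<comment> \<open>Positivity of \<open>N\<close> ensures that the term for
        \<open>k = 0\<close>, which is \<open>d j\<close> itself, occurs in the sum.\<close>
      obtain N where N: "(\<Sum>k<N. ?c k * d (j + k) * u ^ k) \<in> ?I" "N > 0"
        using eventually_happens[OF eventually_conj[OF sums[of j n] eventually_gt_at_top[of 0]]] by auto
      define T where "T = (\<Sum>k<N. ?c k * d (j + k) * u ^ k)"
      \<comment> \<open>Later coefficients are replaced by their approximations: \<open>W\<close>
        collects the main terms after extracting \<open>u ^ Suc s\<close>, one factor coming from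
        \<open>u ^ k\<close> with \<open>k \<ge> 1\<close>, and \<open>E\<close> collects the
        errors, which are divisible by \<open>p ^ n\<close>.\<close>
      define W where "W = (\<Sum>k=1..<N. ?c k * u ^ (k - 1) * x (j + k))"
      define E where "E = (\<Sum>k=1..<N. ?c k * u ^ k * (d (j + k) - x (j + k) * u ^ s))"
      have "T = d j + (\<Sum>k=1..<N. ?c k * d (j + k) * u ^ k)"
        unfolding T_def using N(2) by (simp add: lessThan_atLeast0 sum.atLeast_Suc_lessThan)
      also have "(\<Sum>k=1..<N. ?c k * d (j + k) * u ^ k) = W * u ^ Suc s + E"
        unfolding W_def E_def sum_distrib_right sum.distrib[symmetric]
      proof (intro sum.cong refl)
        fix k assume "k \<in> {1..<N}"
        then obtain l where "k = Suc l" by (cases k) auto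
        then show "?c k * d (j + k) * u ^ k =
            ?c k * u ^ (k - 1) * x (j + k) * u ^ Suc s + ?c k * u ^ k * (d (j + k) - x (j + k) * u ^ s)"
          by (simp add: algebra_simps)
      qed
      finally have eq: "d j - (- W) * u ^ Suc s = T - E"
        by (simp add: algebra_simps)
      have "E \<in> ?I"
        unfolding E_def using u x by (intro multiples_sum multiples_mult) simp_all
      then have "d j - (- W) * u ^ Suc s \<in> ?I"
        unfolding eq using N(1) by (intro multiples_diff) (simp_all only: T_def)
      moreover have "- W \<in> A"
        unfolding W_def using u x by (intro uminus_mem sum_mem mult_mem) simp_all
      ultimately show "\<exists>x\<in>A. d j - x * u ^ Suc s \<in> ?I" by blast
    qed
  qed
  \<comment> \<open>With \<open>s = M * n\<close> the factor \<open>u ^ s\<close> is itself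
    divisible by \<open>p ^ n\<close>.\<close>
  then obtain x where x: "x \<in> A" "d j - x * u ^ (M * n) \<in> ?I" by blast
  have "u ^ (M * n) \<in> ?I"
    using power_multiples[OF u(2) of_nat_mem, of n] by (simp add: power_mult)
  then have "x * u ^ (M * n) \<in> ?I" using x(1) by (intro multiples_mult)
  from multiples_add[OF x(2) this] show ?thesis by simp
qed

end

text \<open>By Bezout some exponent is divisible by \<open>P\<close> and congruent to 1 modulo
  \<open>Q\<close>; it kills \<open>a\<close> and preserves \<open>b\<close>.\<close>

lemma root_of_unity_product_power:
  fixes a b :: complex
  assumes "a ^ P = 1" "b ^ Q = 1" "coprime P Q" "P > 0"
  shows "\<exists>k. b = (a * b) ^ k"
proof -
  obtain x y where xy: "P * x = Q * y + 1" using bezout_nat[of P Q] assms by auto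
  have "(a * b) ^ (P * x) = (a ^ P) ^ x * b ^ (P * x)"
    by (simp only: power_mult_distrib power_mult)
  also have "\<dots> = (b ^ Q) ^ y * b"
    unfolding xy by (simp add: assms(1) power_mult)
  finally show ?thesis using assms(2) by (intro exI[of _ "P * x"]) simp
qed

text \<open>Write \<open>m = p ^ r * m'\<close> with \<open>m'\<close> prime to \<open>p\<close>.
  Both factors of \<open>\<zeta> (p * m) = \<zeta> P * \<zeta> m'\<close> are powers of the product,
  which gives membership. Raising to \<open>P = p ^ Suc r\<close> kills the \<open>p\<close>-parts,
  so \<open>\<zeta> (p * m)\<close> and \<open>\<zeta> m\<close> have equal \<open>P\<close>-th
  powers, and additivity of this power modulo \<open>p\<close> makes the difference
  nilpotent.\<close>

lemma
  assumes \<zeta>: "compatible_roots \<zeta>" and m: "m \<ge> 1" and p: "Factorial_Ring.prime p"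
  defines "O' \<equiv> generate_ring ring_of_type_algebra {\<zeta> (p * m)}"
  shows compatible_root_mem: "\<zeta> m \<in> O'"
    and compatible_root_diff_nilpotent:
      "\<exists>M. (\<zeta> (p * m) - \<zeta> m) ^ M \<in> subring_set.multiples O' (of_nat p)"
proof -
  interpret subring_set O' unfolding O'_def by (rule subring_set_generate_ring)
  have root: "\<zeta> k ^ k = 1" if "k \<ge> 1" for k using \<zeta> that by (auto simp: compatible_roots_def)
  define r where "r = multiplicity p m"
  obtain m' where m': "m = p ^ r * m'" "\<not> p dvd m'"
    using multiplicity_decompose'[of m p] m p unfolding r_def
    by (metis not_one_le_zero not_prime_unit)
  have "p > 0" using p prime_gt_0_nat by blast
  have "m' \<ge> 1" using m m' by (cases m') auto
  have cop: "coprime (p ^ k) m'" for k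
    using p m'(2) prime_imp_coprime by (simp add: prime_imp_coprime)
  define P where "P = p ^ Suc r"
  have "P > 0" using \<open>p > 0\<close> by (simp add: P_def)
  have \<zeta>m: "\<zeta> m = \<zeta> (p ^ r) * \<zeta> m'"
    using \<zeta> cop[of r] \<open>m' \<ge> 1\<close> \<open>p > 0\<close> unfolding m'(1) compatible_roots_def by simp
  have pm: "p * m = P * m'" by (simp add: P_def m'(1))
  have \<zeta>pm: "\<zeta> (p * m) = \<zeta> P * \<zeta> m'"
    using \<zeta> cop[of "Suc r"] \<open>m' \<ge> 1\<close> \<open>P > 0\<close> unfolding pm compatible_roots_def P_def by simp
  have \<zeta>P: "\<zeta> P ^ p = \<zeta> (p ^ r)"
    using \<zeta> p unfolding compatible_roots_def P_def by (metis diff_Suc_1 le_add1 plus_1_eq_Suc)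
  have O: "\<zeta> (p * m) \<in> O'" unfolding O'_def by (rule generate_ring.incl) simp
  have roots: "\<zeta> P ^ P = 1" "\<zeta> m' ^ m' = 1" using root \<open>P > 0\<close> \<open>m' \<ge> 1\<close> by simp_all
  have cop': "coprime P m'" "coprime m' P" using cop[of "Suc r"] by (simp_all add: P_def coprime_commute)
  obtain k where "\<zeta> m' = \<zeta> (p * m) ^ k"
    using root_of_unity_product_power[OF roots cop'(1) \<open>P > 0\<close>] unfolding \<zeta>pm by blast
  then have "\<zeta> m' \<in> O'" using O by simp
  moreover obtain l where "\<zeta> P = \<zeta> (p * m) ^ l"
    using root_of_unity_product_power[OF roots(2,1) cop'(2)] \<open>m' \<ge> 1\<close>
    unfolding \<zeta>pm mult.commute[of "\<zeta> P"] by auto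
  then have "\<zeta> P \<in> O'" using O by simp
  ultimately show mem: "\<zeta> m \<in> O'" unfolding \<zeta>m \<zeta>P[symmetric] by simp
  have "\<zeta> (p ^ r) ^ P = 1"
    unfolding \<zeta>P[symmetric] power_mult[symmetric] mult.commute[of p] by (simp add: power_mult roots(1))
  then have "\<zeta> (p * m) ^ P = \<zeta> m ^ P"
    using roots unfolding \<zeta>m \<zeta>pm by (simp add: power_mult_distrib)
  moreover have "\<zeta> (p * m) ^ P - ((\<zeta> (p * m) - \<zeta> m) ^ P + \<zeta> m ^ P) \<in> multiples (of_nat p)"
    using add_power_prime_power[OF p, of "\<zeta> (p * m) - \<zeta> m" "\<zeta> m" "Suc r"] O mem by (simp add: P_def)
  ultimately have "- ((\<zeta> (p * m) - \<zeta> m) ^ P) \<in> multiples (of_nat p)" by simp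
  then show "\<exists>M. (\<zeta> (p * m) - \<zeta> m) ^ M \<in> multiples (of_nat p)"
    using multiples_uminus by (metis minus_minus)
qed

lemma compatible_roots_1: "compatible_roots \<zeta> \<Longrightarrow> \<zeta> 1 = 1"
  unfolding compatible_roots_def by (metis le_refl power_one_right)

section \<open>The Habiro ring\<close>

context
  fixes \<zeta> :: "nat \<Rightarrow> complex" and \<Delta> :: laurent
  assumes roots: "compatible_roots \<zeta>" and \<Delta>: "laurent_eval \<Delta> (1 :: complex) = 1"
begin

lemma separated_coeff_ring:
  assumes "m \<ge> 1" "Factorial_Ring.prime p"
  shows "subring_set.padically_separated (coeff_ring \<Delta> (\<zeta> (p * m)) m) p"
proof (rule coeff_ring_separated[OF \<Delta>])
  show "p * m > 0" using assms prime_gt_0_nat by simp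
  then show "\<zeta> (p * m) ^ (p * m) = 1" using roots by (simp add: compatible_roots_def)
qed (use assms prime_gt_1_nat in auto)

text \<open>Both images are limits of the same re-expansion of \<open>f\<close>, hence equal.
  Uniqueness of the Frobenius brings them under one \<phi>, which is injective on
  coefficients.\<close>

lemma glued_right_unique:
  assumes m: "m \<ge> 1" and p: "Factorial_Ring.prime p"
    and g: "g \<in> series_over (coeff_ring \<Delta> (\<zeta> (p * m)) (p * m))"
      "g' \<in> series_over (coeff_ring \<Delta> (\<zeta> (p * m)) (p * m))"
    and glued: "glued \<zeta> \<Delta> p m f g" "glued \<zeta> \<Delta> p m f g'"
  shows "g = g'"
proof (rule fps_ext)
  fix j
  let ?A' = "coeff_ring \<Delta> (\<zeta> (p * m)) (p * m)" and ?A = "coeff_ring \<Delta> (\<zeta> (p * m)) m"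
  interpret A: subring_set ?A by (rule subring_set_coeff_ring)
  have gA: "fps_nth g j \<in> ?A'" "fps_nth g' j \<in> ?A'" using g by (auto simp: series_over_def)
  obtain \<phi> \<phi>' where \<phi>: "frobenius \<zeta> \<Delta> p m \<phi>" "frobenius \<zeta> \<Delta> p m \<phi>'"
    and sums: "reexpands_to p ?A (\<zeta> m) (\<zeta> (p * m)) f (\<lambda>j. \<phi> (to_completion p ?A' (fps_nth g j)))"
      "reexpands_to p ?A (\<zeta> m) (\<zeta> (p * m)) f (\<lambda>j. \<phi>' (to_completion p ?A' (fps_nth g' j)))"
    using glued unfolding glued_def by blast
  have "\<phi> (to_completion p ?A' (fps_nth g j)) = \<phi>' (to_completion p ?A' (fps_nth g' j))"
    using sums unfolding reexpands_to_def by (blast intro: A.padic_sums_unique)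
  also have "\<dots> = \<phi> (to_completion p ?A' (fps_nth g' j))"
    by (rule frobenius_unique[OF \<phi>(2,1) gA(2) \<Delta>])
  finally show "fps_nth g j = fps_nth g' j"
    by (rule frobenius_inject[OF \<phi>(1) gA separated_coeff_ring[OF m p]])
qed

text \<open>The series \<open>f\<close> and \<open>f'\<close> have the same re-expansion, so that of
  \<open>f - f'\<close> is zero; as the shift \<open>u\<close> is nilpotent modulo \<open>p\<close>,
  its coefficients are divisible by every \<open>p ^ n\<close>.\<close>

lemma glued_left_unique:
  assumes m: "m \<ge> 1" and p: "Factorial_Ring.prime p"
    and f: "f \<in> series_over (coeff_ring \<Delta> (\<zeta> m) m)" "f' \<in> series_over (coeff_ring \<Delta> (\<zeta> m) m)"
    and g: "g \<in> series_over (coeff_ring \<Delta> (\<zeta> (p * m)) (p * m))"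
    and glued: "glued \<zeta> \<Delta> p m f g" "glued \<zeta> \<Delta> p m f' g"
  shows "f = f'"
proof (rule fps_ext)
  fix i
  let ?A' = "coeff_ring \<Delta> (\<zeta> (p * m)) (p * m)" and ?A = "coeff_ring \<Delta> (\<zeta> (p * m)) m"
  let ?O = "generate_ring ring_of_type_algebra {\<zeta> (p * m)}"
  interpret A: subring_set ?A by (rule subring_set_coeff_ring)
  interpret O: subring_set ?O by (rule subring_set_generate_ring)
  have const_A: "const a \<in> ?A" if "a \<in> ?O" for a
    using that by (rule const_mem[OF A.subring_set_axioms coeff_ring_generators(1)])
  define u where "u = const (\<zeta> (p * m) - \<zeta> m)"
  have "\<zeta> (p * m) \<in> ?O" by (rule generate_ring.incl) simp
  then have uA: "u \<in> ?A"
    unfolding u_def using compatible_root_mem[OF roots m p] by (intro const_A O.diff_mem)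
  obtain M where M: "(\<zeta> (p * m) - \<zeta> m) ^ M \<in> O.multiples (of_nat p)"
    using compatible_root_diff_nilpotent[OF roots m p] by blast
  then obtain r where r: "r \<in> ?O" "(\<zeta> (p * m) - \<zeta> m) ^ M = r * of_nat p"
    unfolding O.multiples_iff by blast
  then have "u ^ M = const r * of_nat p"
    unfolding u_def by (simp add: const_mult const_of_nat flip: const_power)
  then have uM: "u ^ M \<in> A.multiples (of_nat p)"
    unfolding A.multiples_iff using const_A[OF r(1)] by blast
  \<comment> \<open>Re-expansion takes place over the ring with the larger root of unity, so the
    coefficients of \<open>f\<close> and \<open>f'\<close> are first moved there.\<close>
  have "coeff_ring \<Delta> (\<zeta> m) m \<subseteq> ?A"
    unfolding coeff_ring_def[of \<Delta> "\<zeta> m"]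
    using const_A[OF compatible_root_mem[OF roots m p]]
    by (intro generate_ring_subset A.subring_set_axioms) (auto intro: coeff_ring_generators)
  then have fA: "fps_nth f k - fps_nth f' k \<in> ?A" for k
    using f by (auto simp: series_over_def intro!: A.diff_mem)
  obtain \<phi> \<phi>' where \<phi>: "frobenius \<zeta> \<Delta> p m \<phi>" "frobenius \<zeta> \<Delta> p m \<phi>'"
    and sums: "reexpands_to p ?A (\<zeta> m) (\<zeta> (p * m)) f (\<lambda>j. \<phi> (to_completion p ?A' (fps_nth g j)))"
      "reexpands_to p ?A (\<zeta> m) (\<zeta> (p * m)) f' (\<lambda>j. \<phi>' (to_completion p ?A' (fps_nth g j)))"
    using glued unfolding glued_def by blast
  have "\<phi>' (to_completion p ?A' (fps_nth g j)) = \<phi> (to_completion p ?A' (fps_nth g j))" for j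
    using g by (intro frobenius_unique[OF \<phi>(2,1) _ \<Delta>]) (auto simp: series_over_def)
  with sums have diff: "\<forall>\<^sub>F N in sequentially. (\<Sum>k<N. of_nat ((j + k) choose j) * fps_nth f (j + k) * u ^ k -
      of_nat ((j + k) choose j) * fps_nth f' (j + k) * u ^ k) \<in> A.multiples (of_nat (p ^ n))" for j n
    unfolding reexpands_to_def u_def by (intro A.padic_sums_diff) auto
  have "fps_nth f i - fps_nth f' i \<in> A.multiples (of_nat (p ^ n))" for n
  proof (rule A.reexpansion_eq_0[OF uA uM fA])
    fix j n
    show "\<forall>\<^sub>F N in sequentially. (\<Sum>k<N. of_nat ((j + k) choose j) * (fps_nth f (j + k) - fps_nth f' (j + k)) * u ^ k)
        \<in> A.multiples (of_nat (p ^ n))"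
      using diff[of j n] by (simp add: algebra_simps)
  qed
  then have "fps_nth f i - fps_nth f' i = 0"
    using separated_coeff_ring[OF m p] unfolding A.padically_separated_def by blast
  then show "fps_nth f i = fps_nth f' i" by simp
qed

lemma habiro_ringD:
  assumes "F \<in> habiro_ring \<zeta> \<Delta>" "m \<ge> 1"
  shows "F m \<in> series_over (coeff_ring \<Delta> (\<zeta> m) m)"
    and "Factorial_Ring.prime p \<Longrightarrow> glued \<zeta> \<Delta> p m (F m) (F (p * m))"
  using assms by (auto simp: habiro_ring_def)

lemma habiro_ring_eqI:
  assumes F: "F \<in> habiro_ring \<zeta> \<Delta>" and G: "G \<in> habiro_ring \<zeta> \<Delta>" and m: "m \<ge> 1" "F m = G m"
  shows "F = G"
proof -
  have factor: "\<exists>p k'. Factorial_Ring.prime p \<and> k = p * k' \<and> 1 \<le> k' \<and> k' < k" if gt: "k > 1" for k :: nat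
  proof -
    obtain p where p: "Factorial_Ring.prime p" "p dvd k"
      using prime_factor_nat[of k] gt by auto
    then obtain k' where k': "k = p * k'" by (auto elim: dvdE)
    then have "k' \<noteq> 0" using gt by (intro notI) simp
    moreover have "p > 1" using p(1) by (rule prime_gt_1_nat)
    ultimately have "1 \<le> k'" "k' < k" by (simp_all add: k' Suc_le_eq)
    with p(1) k' show ?thesis by blast
  qed
  have *: "F k \<in> series_over (coeff_ring \<Delta> (\<zeta> k) k)" "G k \<in> series_over (coeff_ring \<Delta> (\<zeta> k) k)"
    if "k \<ge> 1" for k
    using habiro_ringD(1)[OF F that] habiro_ringD(1)[OF G that] by auto
  have step: "F k = G k \<longleftrightarrow> F (p * k) = G (p * k)" if "k \<ge> 1" "Factorial_Ring.prime p" for k p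
  proof -
    have "p * k \<ge> 1" using that prime_gt_0_nat[of p] by (simp add: Suc_le_eq)
    note mem = *[OF \<open>k \<ge> 1\<close>] *[OF this]
    have glued: "glued \<zeta> \<Delta> p k (F k) (F (p * k))" "glued \<zeta> \<Delta> p k (G k) (G (p * k))"
      using habiro_ringD(2) F G that by auto
    show ?thesis
    proof
      assume "F k = G k"
      with glued show "F (p * k) = G (p * k)"
        by (intro glued_right_unique[OF that mem(3,4)]) auto
    next
      assume "F (p * k) = G (p * k)"
      with glued show "F k = G k"
        by (intro glued_left_unique[OF that mem(1,2,3)]) auto
    qed
  qed
  \<comment> \<open>Removing one prime factor at a time leads to 1. As an equivalence this can be
    followed from \<open>m\<close> down to 1 and then up to any \<open>k\<close>.\<close>
  have one: "F k = G k \<longleftrightarrow> F 1 = G 1" if "k \<ge> 1" for k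
    using that
  proof (induction k rule: less_induct)
    case (less k)
    show ?case
    proof (cases "k = 1")
      case False
      with less.prems obtain p k' where k': "Factorial_Ring.prime p" "k = p * k'" "1 \<le> k'" "k' < k"
        using factor[of k] by auto
      then show ?thesis using step[of k' p] less.IH[of k'] by simp
    qed simp
  qed
  then have all: "F k = G k" if "k \<ge> 1" for k using m that by metis
  show ?thesis
  \<comment> \<open>Extensionality of the product settles the index 0, where both families are
    \<open>undefined\<close>.\<close>
  proof (rule PiE_ext)
    show "F \<in> (\<Pi>\<^sub>E k\<in>{1..}. series_over (coeff_ring \<Delta> (\<zeta> k) k))"
      "G \<in> (\<Pi>\<^sub>E k\<in>{1..}. series_over (coeff_ring \<Delta> (\<zeta> k) k))"
      using F G by (simp_all add: habiro_ring_def)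
  qed (use all in simp)
qed

text \<open>The component at 1 satisfies the interpolation property, and
  \<open>specialize_inject\<close> makes it the only series that does; this evaluates the definite
  description.\<close>

lemma jones_lift_loop_expansion:
  assumes J: "jones_lift \<zeta> K \<Delta> J"
  shows "J 1 = loop_expansion K \<Delta>"
proof -
  have "J \<in> habiro_ring \<zeta> \<Delta>" using J by (simp add: jones_lift_def)
  then have J1: "J 1 \<in> series_over (coeff_ring \<Delta> 1 1)"
    using habiro_ringD(1)[of J 1] compatible_roots_1[OF roots] by simp
  have spec: "specialize 1 (int n - 1) (J 1) = laurent_eval (colored_jones K n) (q_at 1)" if "n > 0" for n
    using J that compatible_roots_1[OF roots] unfolding jones_lift_def by (metis le_refl)
  have regular: "regular (fps_nth L k)" if "L \<in> series_over (coeff_ring \<Delta> 1 1)" for L k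
    using that coeff_ring_taylor(1)[OF \<Delta>] by (auto simp: series_over_def)
  show ?thesis
    unfolding loop_expansion_def
  proof (rule the_equality[symmetric])
    show "J 1 \<in> series_over (coeff_ring \<Delta> 1 1) \<and>
        (\<forall>n>0. specialize 1 (int n - 1) (J 1) = laurent_eval (colored_jones K n) (q_at 1))"
      using J1 spec by blast
  next
    fix L
    assume L: "L \<in> series_over (coeff_ring \<Delta> 1 1) \<and>
        (\<forall>n>0. specialize 1 (int n - 1) L = laurent_eval (colored_jones K n) (q_at 1))"
    show "L = J 1"
    proof (rule specialize_inject)
      fix r
      \<comment> \<open>Dimension \<open>Suc r\<close> corresponds to \<open>t = q ^ r\<close>, so
        every \<open>r \<ge> 0\<close> is reached.\<close>
      have "specialize 1 (int (Suc r) - 1) L = laurent_eval (colored_jones K (Suc r)) (q_at 1)"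
        using L by blast
      also have "\<dots> = specialize 1 (int (Suc r) - 1) (J 1)"
        by (rule spec[symmetric]) simp
      finally have "specialize 1 (int (Suc r) - 1) L = specialize 1 (int (Suc r) - 1) (J 1)" .
      then show "specialize 1 (int r) L = specialize 1 (int r) (J 1)" by simp
    qed (use L J1 regular in auto)
  qed
qed

end

theorem corollary1p5:
  fixes K :: "(complex \<times> complex) set"
    and \<Delta> :: laurent
    and \<zeta> :: "nat \<Rightarrow> complex"
    and J :: "nat \<Rightarrow> ratfun fps"
  assumes "knot K"
    and "alexander_polynomial K \<Delta>"
    and "compatible_roots \<zeta>"
    and "jones_lift \<zeta> K \<Delta> J"
  shows "J 1 = loop_expansion K \<Delta>
      \<and> loop_expansion K \<Delta> \<in> series_over (coeff_ring \<Delta> 1 1)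
      \<and> (\<forall>m\<ge>1. J m \<in> series_over (coeff_ring \<Delta> (\<zeta> m) m))
      \<and> (\<exists>!F. F \<in> habiro_ring \<zeta> \<Delta> \<and> F 1 = loop_expansion K \<Delta>)
      \<and> (\<forall>m\<ge>1. \<forall>p. Factorial_Ring.prime p \<longrightarrow>
            glued \<zeta> \<Delta> p m (J m) (J (p * m))
          \<and> (\<forall>g\<in>series_over (coeff_ring \<Delta> (\<zeta> (p * m)) (p * m)).
                glued \<zeta> \<Delta> p m (J m) g \<longrightarrow> g = J (p * m))
          \<and> (\<forall>f\<in>series_over (coeff_ring \<Delta> (\<zeta> m) m).
                glued \<zeta> \<Delta> p m f (J (p * m)) \<longrightarrow> f = J m))
      \<and> (\<forall>m\<ge>1. \<forall>F\<in>habiro_ring \<zeta> \<Delta>. F m = J m \<longrightarrow> F = J)"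
proof -
  have \<Delta>: "laurent_eval \<Delta> (1 :: complex) = 1"
    using assms(2) by (simp add: alexander_polynomial_def)
  have J: "J \<in> habiro_ring \<zeta> \<Delta>" using assms(4) by (simp add: jones_lift_def)
  note J_mem = habiro_ringD(1)[OF assms(3) \<Delta> J]
  have loop: "J 1 = loop_expansion K \<Delta>"
    by (rule jones_lift_loop_expansion[OF assms(3) \<Delta> assms(4)])
  have determined: "F = J" if "m \<ge> 1" "F \<in> habiro_ring \<zeta> \<Delta>" "F m = J m" for m F
    by (rule habiro_ring_eqI[OF assms(3) \<Delta> that(2) J that(1,3)])
  show ?thesis
  proof (intro conjI allI impI ballI)
    show "J 1 = loop_expansion K \<Delta>" by (rule loop)
    show "loop_expansion K \<Delta> \<in> series_over (coeff_ring \<Delta> 1 1)"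
      using J_mem[of 1] compatible_roots_1[OF assms(3)] loop by simp
    \<comment> \<open>The lift \<open>J\<close> itself supplies existence; uniqueness is rigidity of
      the Habiro ring at index 1.\<close>
    show "\<exists>!F. F \<in> habiro_ring \<zeta> \<Delta> \<and> F 1 = loop_expansion K \<Delta>"
    proof (rule ex1I)
      show "J \<in> habiro_ring \<zeta> \<Delta> \<and> J 1 = loop_expansion K \<Delta>"
        using J loop by simp
      show "F = J" if "F \<in> habiro_ring \<zeta> \<Delta> \<and> F 1 = loop_expansion K \<Delta>" for F
        by (rule determined[of 1]) (use that loop in auto)
    qed
  next
    fix m p :: nat
    assume m: "m \<ge> 1" and p: "Factorial_Ring.prime p"
    have pm: "p * m \<ge> 1" using m prime_gt_0_nat[OF p] by (simp add: Suc_le_eq)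
    show glued: "glued \<zeta> \<Delta> p m (J m) (J (p * m))"
      by (rule habiro_ringD(2)[OF assms(3) \<Delta> J m p])
    fix g
    assume "g \<in> series_over (coeff_ring \<Delta> (\<zeta> (p * m)) (p * m))" "glued \<zeta> \<Delta> p m (J m) g"
    then show "g = J (p * m)"
      using glued_right_unique[OF assms(3) \<Delta> m p _ J_mem[OF pm] _ glued] by blast
  next
    fix m p :: nat and f
    assume m: "m \<ge> 1" and p: "Factorial_Ring.prime p"
      and f: "f \<in> series_over (coeff_ring \<Delta> (\<zeta> m) m)" "glued \<zeta> \<Delta> p m f (J (p * m))"
    have pm: "p * m \<ge> 1" using m prime_gt_0_nat[OF p] by (simp add: Suc_le_eq)
    show "f = J m"
      by (rule glued_left_unique[OF assms(3) \<Delta> m p f(1) J_mem[OF m] J_mem[OF pm] f(2)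
            habiro_ringD(2)[OF assms(3) \<Delta> J m p]])
  next
    show "J m \<in> series_over (coeff_ring \<Delta> (\<zeta> m) m)" if "m \<ge> 1" for m
      using that by (rule J_mem)
    show "F = J" if "m \<ge> 1" "F \<in> habiro_ring \<zeta> \<Delta>" "F m = J m" for m F
      using that by (rule determined)
  qed
qed

end
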